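(* Let $p\in(0,1)$ and let $(X_n)_{n\in\mathbb{Z}}$ be a stationary, strongly mixing sequence of real-valued random variables with distribution function $F$ and strong mixing coefficients $\alpha(n)$. Let $t_p=F^{-1}(p)$. Assume that for some $\rho>0$ and some $M\neq 0$ $$F(t_p+h)-F(t_p)=M|h|^\rho\operatorname{sgn}(h)+o(|h|^\rho)\quad\text{as }h\to 0,$$ and that $\sum_{n=1}^\infty\alpha(n)<\infty$. Then, as $n\to\infty$, $n^{1/(2\rho)}\bigl(F_n^{-1}(p)-t_p\bigr)$ converges in distribution to $C|W|^{1/\rho}\operatorname{sgn}(W)$, where $C$ is a constant and $W$ is a normally distributed random variable.
   Context: For a distribution function $G$ and $p\in(0,1)$, the $p$-quantile is $G^{-1}(p):=\inf\{t\in\mathbb{R}: G(t)\ge p\}$. The empirical distribution function is $F_n(t):=\frac1n\sum_{i=1}^n \mathbf{1}_{\{X_i\le t\}}$, and $F_n^{-1}(p)$ is its $p$-quantile (the empirical $p$-quantile). The strong mixing coefficients are $$\alpha(k):=\sup\{|P(A\cap B)-P(A)P(B)|: A\in\mathcal{F}_1^n,\ B\in\mathcal{F}_{n+k}^\infty,\ n\in\mathbb{Z}\},$$ where $\mathcal{F}_a^l$ is the $\sigma$-field generated by $X_a,\ldots,X_l$ (trivial if $l<a$); the sequence is strongly mixing if $\alpha(k)\to 0$ as $k\to\infty$. Convention: $\operatorname{sgn}(0)=0$. (Since $F$ is nondecreasing, $M\ne 0$ forces $M>0$.) *)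

theory Defs
  imports "HOL-Probability.Probability"
begin

definition quantile :: "(real \<Rightarrow> real) \<Rightarrow> real \<Rightarrow> real" where
  "quantile G p = Inf {t. G t \<ge> p}"

definition empirical_cdf :: "(int \<Rightarrow> 'a \<Rightarrow> real) \<Rightarrow> nat \<Rightarrow> 'a \<Rightarrow> real \<Rightarrow> real" where
  "empirical_cdf X n \<omega> t = (\<Sum>i=1..n. indicat_real {..t} (X (int i) \<omega>)) / real n"

definition stationary :: "'a measure \<Rightarrow> (int \<Rightarrow> 'a \<Rightarrow> real) \<Rightarrow> bool" where
  "stationary P X \<longleftrightarrow>
     (\<forall>J k. finite J \<longrightarrow>
        distr P (Pi\<^sub>M J (\<lambda>_. borel)) (\<lambda>\<omega>. \<lambda>i\<in>J. X (i + k) \<omega>) =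
        distr P (Pi\<^sub>M J (\<lambda>_. borel)) (\<lambda>\<omega>. \<lambda>i\<in>J. X i \<omega>))"

(* For empty I this is the trivial sigma-field {{}, space P}. *)
definition generated_events :: "'a measure \<Rightarrow> (int \<Rightarrow> 'a \<Rightarrow> real) \<Rightarrow> int set \<Rightarrow> 'a set set" where
  "generated_events P X I =
     sigma_sets (space P) {X i -` S \<inter> space P | i S. i \<in> I \<and> S \<in> sets borel}"

definition mixing_coeff :: "'a measure \<Rightarrow> (int \<Rightarrow> 'a \<Rightarrow> real) \<Rightarrow> nat \<Rightarrow> real" where
  "mixing_coeff P X k =
     Sup {\<bar>measure P (A \<inter> B) - measure P A * measure P B\<bar> | A B n.
            A \<in> generated_events P X {1..n} \<and> B \<in> generated_events P X {n + int k..}}"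

definition strongly_mixing :: "'a measure \<Rightarrow> (int \<Rightarrow> 'a \<Rightarrow> real) \<Rightarrow> bool" where
  "strongly_mixing P X \<longleftrightarrow> mixing_coeff P X \<longlonglongrightarrow> 0"

end

(*
Two ingredients. First, a central limit theorem for Y i = f (X i) with f bounded and centred, by a
Stein-type argument in the spirit of Bolthausen: let L j be the part of the normalized sum S whose
indices lie within distance m of j. Mixing makes Y j almost independent of exp (i t (S - L j)), and
a Taylor expansion of exp (- i t L j) gives phi'(t) + t sigma2 phi(t) -> 0 for the characteristic
function phi of S, provided that sqrt n * alpha(m) -> 0 and m / sqrt n -> 0. Such m exist because
alpha is monotone and summable, so that m * alpha(m) -> 0. Integrating the differential inequality
yields phi(t) -> exp (- sigma2 t^2 / 2), also in the degenerate case sigma2 = 0 (where C = 0).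

Second, the quantile is inverted: the normalized quantile deviation is at most x iff
F_n(t_n) >= p with t_n = t_p + x n^(-1/(2 rho)). Since F(t_n) -> F(t_p), the empirical processes at
t_n and t_p differ by a quantity that vanishes in mean, and the expansion of F gives
sqrt n (F(t_n) - p) -> M |x|^rho sgn x.
*)
theory Submission
  imports Defs
begin

subsection \<open>Covariance inequalities\<close>

text \<open>Summability yields m * alpha(m) -> 0 and no better rate, so sqrt n * alpha(m) -> 0 is
  guaranteed only for windows m of order nearly sqrt n. Crude estimates then fail. Bounding
  \<open>L j\<close> by its number of terms gives E (L j)^2 = O(m^2 / n) and a total Taylor error of
  order m^2 / sqrt n; mere counting bounds the variance of the double sum behind the linear Taylor
  term by n * m^3, where n * m^2 is needed. Summability is therefore used again, for E (L j)^2 = O(m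
  / n) and for the fourth-order moments, after which every error is of order m / sqrt n. In the
  quantile part the summands depend on n through the threshold t_n. The limit theorem is applied at
  the fixed threshold t_p only, and the difference is controlled by a second-moment bound that is
  uniform in the summand. The limiting variance thus does not depend on x, so that a single C serves
  all x.\<close>

lemma unit_interval_card_approx:
  fixes u :: real
  assumes "0 \<le> u" "u \<le> 1" "n > 0"
  shows "\<bar>u - real (card {k\<in>{1..n}. real k / real n \<le> u}) / real n\<bar> \<le> 1 / real n"
proof -
  have "{k\<in>{1..n}. real k / real n \<le> u} = {1..nat \<lfloor>real n * u\<rfloor>}"
  proof (intro set_eqI iffI)
    fix k assume "k \<in> {k\<in>{1..n}. real k / real n \<le> u}"
    then show "k \<in> {1..nat \<lfloor>real n * u\<rfloor>}"
      using assms by (auto simp: field_simps le_nat_floor)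
  next
    fix k assume k: "k \<in> {1..nat \<lfloor>real n * u\<rfloor>}"
    then have "real k \<le> real n * u"
      using assms by (auto simp: nat_le_iff le_nat_iff le_floor_iff)
    moreover have "real n * u \<le> real n" using assms by (simp add: mult_left_le)
    ultimately have "k \<le> n" by linarith
    then show "k \<in> {k\<in>{1..n}. real k / real n \<le> u}"
      using k assms \<open>real k \<le> real n * u\<close> by (auto simp: field_simps)
  qed
  then have "card {k\<in>{1..n}. real k / real n \<le> u} = nat \<lfloor>real n * u\<rfloor>" by simp
  moreover have "\<bar>real n * u - real (nat \<lfloor>real n * u\<rfloor>)\<bar> \<le> 1"
    using assms by (simp add: of_nat_nat) linarith
  ultimately have "\<bar>real n * u - real (card {k\<in>{1..n}. real k / real n \<le> u})\<bar> / real n \<le> 1 / real n"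
    by (intro divide_right_mono) simp_all
  moreover have "\<bar>real n * u - real c\<bar> / real n = \<bar>u - real c / real n\<bar>" for c
  proof -
    have "\<bar>real n * u - real c\<bar> / real n = \<bar>(real n * u - real c) / real n\<bar>" by simp
    also have "(real n * u - real c) / real n = u - real c / real n" using assms by (simp add: diff_divide_distrib)
    finally show ?thesis .
  qed
  ultimately show ?thesis by simp
qed

context prob_space
begin

lemma integrable_bounded:
  fixes f :: "'a \<Rightarrow> 'b::{banach, second_countable_topology}"
  assumes "f \<in> borel_measurable M" "\<And>x. norm (f x) \<le> B"
  shows "integrable M f"
  using assms by (intro integrable_const_bound[of f B]) auto

lemma norm_expectation_le:
  fixes f :: "'a \<Rightarrow> 'b::{banach, second_countable_topology}"
  assumes "f \<in> borel_measurable M" "\<And>x. norm (f x) \<le> B"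
  shows "norm (expectation f) \<le> B"
proof -
  have i: "integrable M f" by (rule integrable_bounded[OF assms])
  have "norm (expectation f) \<le> expectation (\<lambda>x. norm (f x))" by simp
  also have "\<dots> \<le> expectation (\<lambda>x. B)"
    using i assms(2) by (intro integral_mono) auto
  also have "\<dots> = B" by (simp add: prob_space)
  finally show ?thesis .
qed

text \<open>Layer-cake argument: the average of the indicators of the superlevel sets
  \<open>A k\<close>, k = 1..n, reproduces \<open>U\<close> up to 1/n, and an average of quantities
  bounded by \<open>c\<close> is again bounded by \<open>c\<close>. No constant is lost in passing
  from events to functions with values in [0, 1].\<close>

lemma abs_expectation_mult_le_pos:
  fixes U g :: "'a \<Rightarrow> real"
  assumes sub: "subalgebra M N" and U: "U \<in> borel_measurable N"
    and U01: "\<And>x. 0 \<le> U x" "\<And>x. U x \<le> 1"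
    and g: "g \<in> borel_measurable M" "\<And>x. \<bar>g x\<bar> \<le> 1"
    and c: "\<And>A. A \<in> sets N \<Longrightarrow> \<bar>expectation (\<lambda>x. indicat_real A x * g x)\<bar> \<le> c"
  shows "\<bar>expectation (\<lambda>x. U x * g x)\<bar> \<le> c"
proof (rule field_le_epsilon)
  fix e :: real assume "e > 0"
  then obtain n :: nat where n: "n > 0" "1 / real n < e"
    using ex_inverse_of_nat_less[of e] by (auto simp: inverse_eq_divide)
  have UM[measurable]: "U \<in> borel_measurable M"
    by (rule measurable_from_subalg[OF sub U])
  note g(1)[measurable]
  define A where "A k = {x\<in>space N. real k / real n \<le> U x}" for k
  have A: "A k \<in> sets N" for k
    unfolding A_def using U by measurable
  have [measurable]: "A k \<in> sets M" for k
    using A[of k] sub by (auto simp: subalgebra_def)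
  have sp: "space N = space M" using sub by (simp add: subalgebra_def)
  define V where "V x = (\<Sum>k=1..n. indicat_real (A k) x) / real n" for x
  have [measurable]: "V \<in> borel_measurable M" unfolding V_def by measurable
  have UV: "\<bar>U x - V x\<bar> \<le> 1 / real n" if "x \<in> space M" for x
  proof -
    have "(\<Sum>k=1..n. indicat_real (A k) x) = real (card {k\<in>{1..n}. real k / real n \<le> U x})"
      using that by (simp add: A_def sp indicator_def sum.If_cases Int_def)
    then show ?thesis unfolding V_def using unit_interval_card_approx[OF U01(1) U01(2) n(1)] by simp
  qed
  have iU: "integrable M (\<lambda>x. U x * g x)"
    by (rule integrable_bounded[where B=1])
       (use U01 g in \<open>auto simp: abs_mult intro!: mult_le_one\<close>)
  have iA: "integrable M (\<lambda>x. indicat_real (A k) x * g x)" for k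
    by (rule integrable_bounded[where B=1]) (use g in \<open>auto simp: indicator_def\<close>)
  have V: "V x * g x = (\<Sum>k=1..n. indicat_real (A k) x * g x) / real n" for x
    by (simp add: V_def sum_distrib_right)
  have iV: "integrable M (\<lambda>x. V x * g x)"
    unfolding V by (intro Bochner_Integration.integrable_divide_zero Bochner_Integration.integrable_sum iA)
  have "expectation (\<lambda>x. V x * g x) = (\<Sum>k=1..n. expectation (\<lambda>x. indicat_real (A k) x * g x)) / real n"
    unfolding V integral_divide_zero using iA by (subst Bochner_Integration.integral_sum) auto
  also have "\<bar>\<dots>\<bar> \<le> (\<Sum>k=1..n. c) / real n"
    unfolding abs_divide abs_of_nat
    by (intro divide_right_mono order.trans[OF sum_abs] sum_mono c[OF A] of_nat_0_le_iff)
  also have "\<dots> = c" using n by simp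
  finally have 1: "\<bar>expectation (\<lambda>x. V x * g x)\<bar> \<le> c" .
  have "\<bar>expectation (\<lambda>x. U x * g x) - expectation (\<lambda>x. V x * g x)\<bar>
        = \<bar>expectation (\<lambda>x. (U x - V x) * g x)\<bar>"
    using iU iV by (simp add: left_diff_distrib)
  also have "\<dots> \<le> expectation (\<lambda>x. \<bar>(U x - V x) * g x\<bar>)"
    by (rule integral_abs_bound)
  also have "\<dots> \<le> expectation (\<lambda>x. 1 / real n)"
  proof (rule integral_mono)
    show "integrable M (\<lambda>x. \<bar>(U x - V x) * g x\<bar>)"
      using iU iV by (simp add: left_diff_distrib)
    show "\<bar>(U x - V x) * g x\<bar> \<le> 1 / real n" if "x \<in> space M" for x
      using mult_mono[OF UV[OF that] g(2)[of x]] by (simp add: abs_mult)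
  qed simp
  also have "\<dots> = 1 / real n" by (simp add: prob_space)
  finally show "\<bar>expectation (\<lambda>x. U x * g x)\<bar> \<le> c + e" using 1 n by linarith
qed

text \<open>The factor 2 comes from treating the positive and the negative part of \<open>U\<close>
  separately.\<close>

lemma abs_expectation_mult_le:
  fixes U g :: "'a \<Rightarrow> real"
  assumes sub: "subalgebra M N" and U: "U \<in> borel_measurable N" "\<And>x. \<bar>U x\<bar> \<le> 1"
    and g: "g \<in> borel_measurable M" "\<And>x. \<bar>g x\<bar> \<le> 1"
    and c: "\<And>A. A \<in> sets N \<Longrightarrow> \<bar>expectation (\<lambda>x. indicat_real A x * g x)\<bar> \<le> c"
  shows "\<bar>expectation (\<lambda>x. U x * g x)\<bar> \<le> 2 * c"
proof -
  have UM[measurable]: "U \<in> borel_measurable M"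
    by (rule measurable_from_subalg[OF sub U(1)])
  note g(1)[measurable] U(1)[measurable]
  have b: "max 0 (U x) \<le> 1" "max 0 (- U x) \<le> 1" for x using U(2)[of x] by auto
  have i1: "integrable M (\<lambda>x. max 0 (U x) * g x)"
    by (rule integrable_bounded[where B=1])
       (use b g in \<open>auto simp: abs_mult intro!: mult_le_one\<close>)
  have i2: "integrable M (\<lambda>x. max 0 (- U x) * g x)"
    by (rule integrable_bounded[where B=1])
       (use b g in \<open>auto simp: abs_mult intro!: mult_le_one\<close>)
  have "U x * g x = max 0 (U x) * g x - max 0 (- U x) * g x" for x
    by (auto simp: max_def)
  then have "expectation (\<lambda>x. U x * g x)
     = expectation (\<lambda>x. max 0 (U x) * g x) - expectation (\<lambda>x. max 0 (- U x) * g x)"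
    using i1 i2 by simp
  moreover have "\<bar>expectation (\<lambda>x. max 0 (U x) * g x)\<bar> \<le> c"
    by (rule abs_expectation_mult_le_pos[OF sub]) (use b g c in auto)
  moreover have "\<bar>expectation (\<lambda>x. max 0 (- U x) * g x)\<bar> \<le> c"
    by (rule abs_expectation_mult_le_pos[OF sub]) (use b g c in auto)
  ultimately show ?thesis by linarith
qed

text \<open>Bilinear, without conjugation, so that the complex case expands into four real
  covariances.\<close>

definition cov :: "('a \<Rightarrow> 'b::{real_normed_field, banach, second_countable_topology}) \<Rightarrow> ('a \<Rightarrow> 'b) \<Rightarrow> 'b" where
  "cov U V = expectation (\<lambda>x. U x * V x) - expectation U * expectation V"

text \<open>Two passes from events to functions: \<open>B\<close> is replaced by \<open>V\<close>
  while \<open>A\<close> is fixed, then \<open>A\<close> by \<open>U\<close> while \<open>V\<close>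
  is fixed. Each pass costs a factor 2.\<close>

lemma abs_cov_real_le:
  fixes U V :: "'a \<Rightarrow> real"
  assumes sub: "subalgebra M N" "subalgebra M N'"
    and U: "U \<in> borel_measurable N" "\<And>x. \<bar>U x\<bar> \<le> 1"
    and V: "V \<in> borel_measurable N'" "\<And>x. \<bar>V x\<bar> \<le> 1"
    and c: "\<And>A B. A \<in> sets N \<Longrightarrow> B \<in> sets N' \<Longrightarrow> \<bar>prob (A \<inter> B) - prob A * prob B\<bar> \<le> c"
  shows "\<bar>cov U V\<bar> \<le> 4 * c"
proof -
  have [measurable]: "U \<in> borel_measurable M" "V \<in> borel_measurable M"
    using measurable_from_subalg sub U V by blast+
  have iU: "integrable M U" by (rule integrable_bounded[where B=1]) (use U in auto)
  have iV: "integrable M V" by (rule integrable_bounded[where B=1]) (use V in auto)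
  have iUV: "integrable M (\<lambda>x. U x * V x)"
    by (rule integrable_bounded[where B=1]) (use U V in \<open>auto simp: abs_mult intro!: mult_le_one\<close>)
  have EU: "\<bar>expectation U\<bar> \<le> 1"
    using norm_expectation_le[of U 1] U by simp
  have ev: "\<bar>expectation (\<lambda>x. V x * (indicat_real A x - prob A))\<bar> \<le> 2 * c" if A: "A \<in> sets N" for A
  proof (rule abs_expectation_mult_le[OF sub(2) V])
    have AM[measurable]: "A \<in> sets M" using A sub by (auto simp: subalgebra_def)
    show "(\<lambda>x. indicat_real A x - prob A) \<in> borel_measurable M" by measurable
    show "\<bar>indicat_real A x - prob A\<bar> \<le> 1" for x
      using prob_le_1[of A] measure_nonneg[of M A] by (auto simp: indicator_def)
    fix B assume B: "B \<in> sets N'"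
    have BM[measurable]: "B \<in> sets M" using B sub by (auto simp: subalgebra_def)
    have "indicat_real B x * (indicat_real A x - prob A) = indicat_real (A \<inter> B) x - prob A * indicat_real B x" for x
      by (auto simp: indicator_def)
    moreover have "integrable M (indicat_real (A \<inter> B))" "integrable M (indicat_real B)"
      by (auto intro!: integrable_bounded[where B=1] simp: indicator_def)
    ultimately have "expectation (\<lambda>x. indicat_real B x * (indicat_real A x - prob A)) = prob (A \<inter> B) - prob A * prob B"
      by simp
    then show "\<bar>expectation (\<lambda>x. indicat_real B x * (indicat_real A x - prob A))\<bar> \<le> c"
      using c[OF A B] by simp
  qed
  \<comment> \<open>Centring can double the range of \<open>V\<close>; halving restores the bound 1
    that the second pass requires.\<close>
  have "\<bar>expectation (\<lambda>x. U x * ((V x - expectation V) / 2))\<bar> \<le> 2 * c"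
  proof (rule abs_expectation_mult_le[OF sub(1) U])
    show "(\<lambda>x. (V x - expectation V) / 2) \<in> borel_measurable M" by measurable
    have "\<bar>expectation V\<bar> \<le> 1" using norm_expectation_le[of V 1] V by simp
    then show "\<bar>(V x - expectation V) / 2\<bar> \<le> 1" for x using V(2)[of x] by auto
    fix A assume A: "A \<in> sets N"
    then have AM[measurable]: "A \<in> sets M" using sub by (auto simp: subalgebra_def)
    have i: "integrable M (\<lambda>x. V x * indicat_real A x)"
      by (rule integrable_bounded[where B=1]) (use V in \<open>auto simp: indicator_def\<close>)
    have j: "integrable M (indicat_real A)"
      by (rule integrable_bounded[where B=1]) (auto simp: indicator_def)
    have "expectation (\<lambda>x. indicat_real A x * ((V x - expectation V) / 2))
        = expectation (\<lambda>x. (V x * indicat_real A x - expectation V * indicat_real A x) / 2)"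
      by (simp add: algebra_simps diff_divide_distrib)
    also have "\<dots> = (expectation (\<lambda>x. V x * indicat_real A x) - expectation V * prob A) / 2"
      using i j by simp
    also have "\<dots> = expectation (\<lambda>x. V x * (indicat_real A x - prob A)) / 2"
      using i iV by (simp add: right_diff_distrib)
    finally show "\<bar>expectation (\<lambda>x. indicat_real A x * ((V x - expectation V) / 2))\<bar> \<le> c"
      using ev[OF A] by simp
  qed
  also have "expectation (\<lambda>x. U x * ((V x - expectation V) / 2)) = cov U V / 2"
    unfolding cov_def using iU iV iUV by (simp add: right_diff_distrib mult.commute)
  finally show ?thesis by simp
qed

lemma norm_cov_complex_le:
  fixes U V :: "'a \<Rightarrow> complex"
  assumes sub: "subalgebra M N" "subalgebra M N'"
    and U: "U \<in> borel_measurable N" "\<And>x. norm (U x) \<le> 1"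
    and V: "V \<in> borel_measurable N'" "\<And>x. norm (V x) \<le> 1"
    and c: "\<And>A B. A \<in> sets N \<Longrightarrow> B \<in> sets N' \<Longrightarrow> \<bar>prob (A \<inter> B) - prob A * prob B\<bar> \<le> c"
  shows "norm (cov U V) \<le> 16 * c"
proof -
  have [measurable]: "U \<in> borel_measurable M" "V \<in> borel_measurable M"
    using measurable_from_subalg sub U V by blast+
  note U(1)[measurable] V(1)[measurable]
  have b: "\<bar>Re (U x)\<bar> \<le> 1" "\<bar>Im (U x)\<bar> \<le> 1" "\<bar>Re (V x)\<bar> \<le> 1" "\<bar>Im (V x)\<bar> \<le> 1" for x
    using abs_Re_le_cmod abs_Im_le_cmod U(2)[of x] V(2)[of x] order.trans by blast+
  have iU: "integrable M U" by (rule integrable_bounded[where B=1]) (use U in auto)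
  have iV: "integrable M V" by (rule integrable_bounded[where B=1]) (use V in auto)
  have iUV: "integrable M (\<lambda>x. U x * V x)"
    by (rule integrable_bounded[where B=1]) (use U V in \<open>auto simp: norm_mult intro!: mult_le_one\<close>)
  have i: "integrable M (\<lambda>x. Re (U x) * Re (V x))" "integrable M (\<lambda>x. Im (U x) * Re (V x))"
     "integrable M (\<lambda>x. Re (U x) * Im (V x))" "integrable M (\<lambda>x. Im (U x) * Im (V x))"
    by (auto intro!: integrable_bounded[where B=1] mult_le_one simp: abs_mult b)
  let ?R = "\<lambda>f x. Re (f x)" and ?I = "\<lambda>f x. Im (f x)"
  have bd: "\<bar>cov f g\<bar> \<le> 4 * c" if "f \<in> {?R U, ?I U}" "g \<in> {?R V, ?I V}" for f g
    by (rule abs_cov_real_le[OF sub _ _ _ _ c]) (use that b in auto)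
  have Re: "Re (cov U V) = cov (?R U) (?R V) - cov (?I U) (?I V)"
    unfolding cov_def using iU iV iUV i by (simp flip: integral_Re integral_Im)
  have Im: "Im (cov U V) = cov (?R U) (?I V) + cov (?I U) (?R V)"
    unfolding cov_def using iU iV iUV i by (simp flip: integral_Re integral_Im)
  have "norm (cov U V) \<le> \<bar>Re (cov U V)\<bar> + \<bar>Im (cov U V)\<bar>" by (rule cmod_le)
  also have "\<dots> \<le> 16 * c" unfolding Re Im
    using bd[of "?R U" "?R V"] bd[of "?R U" "?I V"] bd[of "?I U" "?R V"] bd[of "?I U" "?I V"] by auto
  finally show ?thesis .
qed

end

subsection \<open>Mixing processes\<close>

text \<open>Mixed moments are indexed by lists rather than finite sets because an index may occur
  repeatedly.\<close>

lemma prod_list_filter_split: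
  fixes f :: "'i \<Rightarrow> 'b::comm_monoid_mult"
  shows "prod_list (map f ks) = prod_list (map f (filter Q ks)) * prod_list (map f (filter (\<lambda>k. \<not> Q k) ks))"
  by (induction ks) (auto simp: ac_simps)

lemma abs_prod_list_le_one:
  fixes f :: "'i \<Rightarrow> real"
  assumes "\<And>i. \<bar>f i\<bar> \<le> 1"
  shows "\<bar>prod_list (map f ks)\<bar> \<le> 1"
  by (induction ks) (auto simp: abs_mult assms intro!: mult_le_one)

lemma borel_measurable_prod_list:
  fixes f :: "'i \<Rightarrow> 'a \<Rightarrow> real"
  assumes "\<And>k. k \<in> set ks \<Longrightarrow> f k \<in> borel_measurable N"
  shows "(\<lambda>x. prod_list (map (\<lambda>k. f k x) ks)) \<in> borel_measurable N"
  using assms by (induction ks) auto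

lemma complex_of_real_measurable:
  "f \<in> borel_measurable N \<Longrightarrow> (\<lambda>x. complex_of_real (f x)) \<in> borel_measurable N"
  by measurable

text \<open>Each distance is attained at most once on either side of \<open>i\<close>, hence the
  factor 2. The lower bound \<open>s\<close> on the distances keeps the truncated subtraction
  injective on each side.\<close>

lemma sum_shifted_distance_le:
  fixes c :: "nat \<Rightarrow> real" and i :: int
  assumes c: "summable c" "\<And>d. 0 \<le> c d" and J: "finite J" "\<And>j. j \<in> J \<Longrightarrow> s \<le> nat \<bar>i - j\<bar>"
  shows "(\<Sum>j\<in>J. c (nat \<bar>i - j\<bar> - s)) \<le> 2 * suminf c"
proof -
  let ?g = "\<lambda>j. nat \<bar>i - j\<bar> - s"
  have half: "(\<Sum>j\<in>K. c (?g j)) \<le> suminf c" if K: "finite K" "inj_on ?g K" for K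
  proof -
    have "(\<Sum>j\<in>K. c (?g j)) = sum c (?g ` K)"
      using K by (simp add: sum.reindex)
    also have "\<dots> \<le> suminf c"
      using c K by (intro sum_le_suminf) auto
    finally show ?thesis .
  qed
  have "inj_on ?g {j\<in>J. i \<le> j}"
  proof (rule inj_onI)
    fix x y assume "x \<in> {j\<in>J. i \<le> j}" "y \<in> {j\<in>J. i \<le> j}" "?g x = ?g y"
    then show "x = y" using J(2)[of x] J(2)[of y] by auto
  qed
  moreover have "inj_on ?g {j\<in>J. \<not> i \<le> j}"
  proof (rule inj_onI)
    fix x y assume "x \<in> {j\<in>J. \<not> i \<le> j}" "y \<in> {j\<in>J. \<not> i \<le> j}" "?g x = ?g y"
    then show "x = y" using J(2)[of x] J(2)[of y] by auto
  qed
  ultimately have "(\<Sum>j\<in>{j\<in>J. i \<le> j}. c (?g j)) + (\<Sum>j\<in>{j\<in>J. \<not> i \<le> j}. c (?g j)) \<le> suminf c + suminf c"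
    using J(1) by (intro add_mono half) auto
  also have "(\<Sum>j\<in>{j\<in>J. i \<le> j}. c (?g j)) + (\<Sum>j\<in>{j\<in>J. \<not> i \<le> j}. c (?g j)) = (\<Sum>j\<in>J. c (?g j))"
    using J(1) by (subst sum.union_disjoint[symmetric]) (auto intro!: sum.cong)
  finally show ?thesis by simp
qed

lemma sum_distance_le:
  fixes c :: "nat \<Rightarrow> real" and i :: int
  assumes "summable c" "\<And>d. 0 \<le> c d" "finite J"
  shows "(\<Sum>j\<in>J. c (nat \<bar>i - j\<bar>)) \<le> 2 * suminf c"
  using sum_shifted_distance_le[OF assms, of 0 i] by simp

text \<open>The Abel-Olivier-Pringsheim theorem: the block from \<open>n div 2\<close> to n - 1 has
  at least n/2 terms, each at least \<open>b n\<close>, and its sum is small by the Cauchy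
  criterion.\<close>

lemma antimono_summable_imp_mult_tendsto_0:
  fixes b :: "nat \<Rightarrow> real"
  assumes b: "summable b" "antimono b" "\<And>n. 0 \<le> b n"
  shows "(\<lambda>n. real n * b n) \<longlonglongrightarrow> 0"
proof (rule LIMSEQ_I)
  fix r :: real assume "0 < r"
  then obtain N where N: "\<And>m n. m \<ge> N \<Longrightarrow> norm (sum b {m..<n}) < r / 2"
    using b(1) unfolding summable_Cauchy by (metis half_gt_zero)
  show "\<exists>no. \<forall>n\<ge>no. norm (real n * b n - 0) < r"
  proof (intro exI[of _ "2 * N"] allI impI)
    fix n assume n: "2 * N \<le> n"
    have "real n / 2 * b n \<le> real (card {n div 2..<n}) * b n"
      using b(3) by (intro mult_right_mono) auto
    also have "\<dots> = sum (\<lambda>_. b n) {n div 2..<n}" by simp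
    also have "\<dots> \<le> sum b {n div 2..<n}"
      using b(2) by (intro sum_mono) (auto simp: antimono_def)
    also have "\<dots> < r / 2" using N[of "n div 2" n] n by (auto simp: sum_nonneg b(3))
    finally show "norm (real n * b n - 0) < r" using b(3)[of n] by simp
  qed
qed

locale mixing_process = prob_space P for P :: "'a measure" +
  fixes X :: "int \<Rightarrow> 'a \<Rightarrow> real"
  assumes X_measurable[measurable]: "\<And>i. X i \<in> borel_measurable P"
    and stat: "stationary P X"
    and summable_mixing: "summable (\<lambda>n. mixing_coeff P X (Suc n))"
begin

text \<open>The generated events as a measure space, so that measurability of functions with respect
  to them can be expressed.\<close>

definition G :: "int set \<Rightarrow> 'a measure" where
  "G I = sigma (space P) {X i -` S \<inter> space P | i S. i \<in> I \<and> S \<in> sets borel}"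

lemma space_G[simp]: "space (G I) = space P"
  unfolding G_def by (intro space_measure_of) auto

lemma sets_G: "sets (G I) = generated_events P X I"
  by (auto simp: G_def generated_events_def intro!: sets_measure_of)

lemma measurable_G:
  assumes "i \<in> I"
  shows "X i \<in> borel_measurable (G I)"
proof (rule measurableI)
  fix S :: "real set" assume "S \<in> sets borel"
  then show "X i -` S \<inter> space (G I) \<in> sets (G I)"
    unfolding sets_G generated_events_def using assms
    by (auto intro!: sigma_sets.Basic)
qed simp

lemma generated_events_mono: "I \<subseteq> J \<Longrightarrow> generated_events P X I \<subseteq> generated_events P X J"
  unfolding generated_events_def by (intro sigma_sets_mono') blast

lemma generated_events_sets: "generated_events P X I \<subseteq> sets P"
  unfolding generated_events_def by (intro sets.sigma_sets_subset) auto

lemma subalgebra_G: "subalgebra P (G I)"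
  using generated_events_sets[of I] by (simp add: subalgebra_def sets_G)

text \<open>Named in order to prove it nonempty and bounded; only then does the real
  \<open>Sup\<close> behave as a supremum.\<close>

definition mixing_set :: "nat \<Rightarrow> real set" where
  "mixing_set k = {\<bar>measure P (A \<inter> B) - measure P A * measure P B\<bar> | A B n.
            A \<in> generated_events P X {1..n} \<and> B \<in> generated_events P X {n + int k..}}"

lemma mixing_coeff_eq: "mixing_coeff P X k = Sup (mixing_set k)"
  by (simp add: mixing_coeff_def mixing_set_def)

lemma mixing_set_bounds: "x \<in> mixing_set k \<Longrightarrow> 0 \<le> x \<and> x \<le> 1"
proof -
  assume "x \<in> mixing_set k"
  then obtain A B where "x = \<bar>prob (A \<inter> B) - prob A * prob B\<bar>" by (auto simp: mixing_set_def)
  moreover have "prob A * prob B \<le> 1" by (intro mult_le_one) auto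
  moreover have "prob (A \<inter> B) \<le> 1" by simp
  moreover have "0 \<le> prob A * prob B" by simp
  ultimately show ?thesis using measure_nonneg[of P "A \<inter> B"] by linarith
qed

lemma mixing_set_bdd: "bdd_above (mixing_set k)"
  using mixing_set_bounds by (auto simp: bdd_above_def)

lemma mixing_set_nonempty: "mixing_set k \<noteq> {}"
proof -
  have "{} \<in> generated_events P X I" for I
    by (auto simp: generated_events_def intro: sigma_sets.Empty)
  then show ?thesis unfolding mixing_set_def by blast
qed

text \<open>The value at 0 makes the covariance bounds below hold trivially for gap 0.\<close>

definition b :: "nat \<Rightarrow> real" where
  "b k = (if k = 0 then 1 else mixing_coeff P X k)"

lemma mixing_coeff_bounds: "0 \<le> mixing_coeff P X k" "mixing_coeff P X k \<le> 1"
proof -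
  obtain x where "x \<in> mixing_set k" using mixing_set_nonempty by blast
  then have "0 \<le> x" "x \<le> Sup (mixing_set k)"
    using mixing_set_bounds[of x k] cSup_upper[OF _ mixing_set_bdd, of x k] by auto
  then show "0 \<le> mixing_coeff P X k"
    unfolding mixing_coeff_eq by linarith
  show "mixing_coeff P X k \<le> 1"
    unfolding mixing_coeff_eq by (rule cSup_least[OF mixing_set_nonempty]) (use mixing_set_bounds in blast)
qed

lemma b_nonneg: "0 \<le> b k" and b_le_1: "b k \<le> 1"
  by (auto simp: b_def mixing_coeff_bounds)

lemma mixing_set_antimono: "k \<le> l \<Longrightarrow> mixing_set l \<subseteq> mixing_set k"
proof
  fix x assume "k \<le> l" "x \<in> mixing_set l"
  then obtain A B n where *: "x = \<bar>prob (A \<inter> B) - prob A * prob B\<bar>"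
     "A \<in> generated_events P X {1..n}" "B \<in> generated_events P X {n + int l..}"
    unfolding mixing_set_def by blast
  have "B \<in> generated_events P X {n + int k..}"
    using generated_events_mono[of "{n + int l..}" "{n + int k..}"] *(3) \<open>k \<le> l\<close> by auto
  then show "x \<in> mixing_set k" using * unfolding mixing_set_def by blast
qed

lemma b_antimono: "antimono b"
proof (rule antimonoI)
  fix k l :: nat assume "k \<le> l"
  then show "b l \<le> b k"
    using cSup_subset_mono[OF mixing_set_nonempty mixing_set_bdd mixing_set_antimono[OF \<open>k \<le> l\<close>]]
      b_le_1[of l] by (auto simp: b_def mixing_coeff_eq)
qed

lemma b_summable: "summable b"
  using summable_mixing by (subst summable_Suc_iff[symmetric]) (simp add: b_def)

lemma mixing_b:
  assumes "A \<in> sets (G {1..n})" "B \<in> sets (G {n + int k..})"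
  shows "\<bar>prob (A \<inter> B) - prob A * prob B\<bar> \<le> b k"
proof -
  have "\<bar>prob (A \<inter> B) - prob A * prob B\<bar> \<in> mixing_set k"
    using assms unfolding mixing_set_def sets_G by blast
  then show ?thesis
    using cSup_upper[OF _ mixing_set_bdd] mixing_set_bounds[of _ k]
    by (auto simp: b_def mixing_coeff_eq)
qed

lemma measurable_G_imp: "f \<in> measurable (G I) N \<Longrightarrow> f \<in> measurable P N"
  using measurable_from_subalg[OF subalgebra_G] .

lemma norm_cov_le:
  fixes U V :: "'a \<Rightarrow> complex"
  assumes "U \<in> borel_measurable (G {1..n})" "\<And>x. norm (U x) \<le> 1"
    and "V \<in> borel_measurable (G {n + int k..})" "\<And>x. norm (V x) \<le> 1"
  shows "norm (cov U V) \<le> 16 * b k"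
  by (rule norm_cov_complex_le[OF subalgebra_G subalgebra_G assms mixing_b])

text \<open>Splitting off \<open>V\<close> and then \<open>Y\<close> leaves two covariances across a
  gap \<open>l\<close>; the remaining product of expectations vanishes with E Y. The past
  sigma-field starts at index 1, which is why positivity of indices is required here and
  below.\<close>

lemma norm_expectation_sandwich_le:
  fixes U Y V :: "'a \<Rightarrow> complex"
  assumes U: "U \<in> borel_measurable (G {1..j - int l})" "\<And>x. norm (U x) \<le> 1"
    and Y: "Y \<in> borel_measurable (G {j})" "\<And>x. norm (Y x) \<le> 1" "expectation Y = 0" and j: "1 \<le> j"
    and V: "V \<in> borel_measurable (G {j + int l..})" "\<And>x. norm (V x) \<le> 1"
  shows "norm (expectation (\<lambda>x. U x * Y x * V x)) \<le> 32 * b l"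
proof -
  have meas: "f \<in> borel_measurable (G J)" if "f \<in> borel_measurable (G I)" "I \<subseteq> J" for f :: "'a \<Rightarrow> complex" and I J
    using measurable_from_subalg[OF _ that(1), of "G J"] generated_events_mono[OF that(2)]
    by (simp add: subalgebra_def sets_G)
  have "norm (cov (\<lambda>x. U x * Y x) V) \<le> 16 * b l"
  proof (rule norm_cov_le[OF _ _ V])
    show "(\<lambda>x. U x * Y x) \<in> borel_measurable (G {1..j})"
      using meas[OF U(1), of "{1..j}"] meas[OF Y(1), of "{1..j}"] j by (intro borel_measurable_times) auto
    show "norm (U x * Y x) \<le> 1" for x
      using U(2) Y(2) by (auto simp: norm_mult intro!: mult_le_one)
  qed
  moreover have "norm (cov U Y) \<le> 16 * b l"
    by (rule norm_cov_le[OF U _ Y(2)]) (use Y(1) in \<open>auto intro: meas\<close>)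
  moreover have "expectation (\<lambda>x. U x * Y x * V x)
      = cov (\<lambda>x. U x * Y x) V + cov U Y * expectation V"
    by (simp add: cov_def Y(3))
  moreover have "norm (cov U Y * expectation V) \<le> norm (cov U Y) * 1"
    unfolding norm_mult
    by (intro mult_left_mono norm_expectation_le measurable_G_imp[OF V(1)] V(2)) auto
  ultimately show ?thesis
    using norm_triangle_ineq[of "cov (\<lambda>x. U x * Y x) V" "cov U Y * expectation V"] by simp
qed

lemma integral_pair_stationary:
  fixes g :: "real \<Rightarrow> real \<Rightarrow> real"
  assumes [measurable]: "case_prod g \<in> borel_measurable (borel \<Otimes>\<^sub>M borel)"
  shows "expectation (\<lambda>x. g (X (i + k) x) (X (j + k) x)) = expectation (\<lambda>x. g (X i x) (X j x))"
proof -
  let ?J = "{i, j}"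
  have eq: "distr P (Pi\<^sub>M ?J (\<lambda>_. borel)) (\<lambda>\<omega>. \<lambda>i\<in>?J. X (i + k) \<omega>) =
        distr P (Pi\<^sub>M ?J (\<lambda>_. borel)) (\<lambda>\<omega>. \<lambda>i\<in>?J. X i \<omega>)"
    using stat by (auto simp: stationary_def)
  have [measurable]: "(\<lambda>y. g (y i) (y j)) \<in> borel_measurable (Pi\<^sub>M ?J (\<lambda>_. borel))"
  proof -
    have "(\<lambda>y. (y i, y j)) \<in> measurable (Pi\<^sub>M ?J (\<lambda>_. borel)) (borel \<Otimes>\<^sub>M borel)"
      by (intro measurable_Pair measurable_component_singleton) auto
    from measurable_compose[OF this assms] show ?thesis by simp
  qed
  have shift: "(\<integral>y. g (y i) (y j) \<partial>distr P (Pi\<^sub>M ?J (\<lambda>_. borel)) (\<lambda>\<omega>. \<lambda>i\<in>?J. X (i + k) \<omega>))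
      = expectation (\<lambda>x. g (X (i + k) x) (X (j + k) x))" for k
    by (subst integral_distr) (auto intro!: measurable_restrict)
  show ?thesis using shift[of k] shift[of 0] eq by simp
qed

end

locale centred_functional = mixing_process +
  fixes f :: "real \<Rightarrow> real"
  assumes f_measurable[measurable]: "f \<in> borel_measurable borel"
    and f_bounded: "\<And>x. \<bar>f x\<bar> \<le> 1"
    and f_centred: "\<And>i. expectation (\<lambda>x. f (X i x)) = 0"
begin

definition Y :: "int \<Rightarrow> 'a \<Rightarrow> real" where "Y i x = f (X i x)"

lemma Y_measurable[measurable]: "Y i \<in> borel_measurable P"
  unfolding Y_def by measurable

lemma Y_measurable_G: "i \<in> I \<Longrightarrow> Y i \<in> borel_measurable (G I)"
  using measurable_compose[OF measurable_G f_measurable] by (simp add: Y_def[abs_def])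

lemma Y_bounded: "\<bar>Y i x\<bar> \<le> 1" and Y_centred: "expectation (Y i) = 0"
  using f_bounded f_centred by (simp_all add: Y_def[abs_def])

text \<open>The indices in \<open>ks\<close> may lie on both sides of \<open>i\<close>: those below
  \<open>i\<close> form the past factor, the others the future factor around the isolated centred
  variable \<open>Y i\<close>.\<close>

lemma abs_expectation_prod_list_le:
  assumes i: "1 \<le> i" and ks: "\<And>k. k \<in> set ks \<Longrightarrow> 1 \<le> k \<and> int l \<le> \<bar>i - k\<bar>"
  shows "\<bar>expectation (\<lambda>x. Y i x * prod_list (map (\<lambda>k. Y k x) ks))\<bar> \<le> 32 * b l"
proof -
  let ?U = "\<lambda>x. complex_of_real (prod_list (map (\<lambda>k. Y k x) (filter (\<lambda>k. k < i) ks)))"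
  let ?V = "\<lambda>x. complex_of_real (prod_list (map (\<lambda>k. Y k x) (filter (\<lambda>k. \<not> k < i) ks)))"
  have "norm (expectation (\<lambda>x. ?U x * complex_of_real (Y i x) * ?V x)) \<le> 32 * b l"
  proof (rule norm_expectation_sandwich_le[OF _ _ _ _ _ i])
    show "?U \<in> borel_measurable (G {1..i - int l})"
      by (intro complex_of_real_measurable borel_measurable_prod_list Y_measurable_G) (use ks in force)
    show "?V \<in> borel_measurable (G {i + int l..})"
      by (intro complex_of_real_measurable borel_measurable_prod_list Y_measurable_G) (use ks in force)
    show "(\<lambda>x. complex_of_real (Y i x)) \<in> borel_measurable (G {i})"
      by (auto intro!: complex_of_real_measurable Y_measurable_G)
  qed (auto simp: Y_bounded Y_centred abs_prod_list_le_one)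
  also have "(\<lambda>x. ?U x * complex_of_real (Y i x) * ?V x)
     = (\<lambda>x. complex_of_real (Y i x * prod_list (map (\<lambda>k. Y k x) ks)))"
    by (subst prod_list_filter_split[of _ ks "\<lambda>k. k < i"]) (simp add: ac_simps)
  finally show ?thesis by (simp del: of_real_mult)
qed

end

context mixing_process
begin

subsection \<open>Second and fourth moments\<close>

definition A :: real where "A = suminf b"

text \<open>The tail over indices strictly above \<open>r\<close>, which are the distances that a
  window of radius \<open>r\<close> leaves out.\<close>

definition T :: "nat \<Rightarrow> real" where "T r = (\<Sum>d. b (d + Suc r))"

lemma A_ge_1: "1 \<le> A"
proof -
  have "sum b {0} \<le> suminf b" by (rule sum_le_suminf[OF b_summable]) (auto simp: b_nonneg)
  then show ?thesis by (simp add: A_def b_def)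
qed

lemma summable_b_shift: "summable (\<lambda>d. b (d + k))"
  using b_summable by (subst summable_iff_shift)

lemma T_nonneg: "0 \<le> T r"
  unfolding T_def by (rule suminf_nonneg[OF summable_b_shift b_nonneg])

lemma T_le_A: "T r \<le> A"
proof -
  have "suminf b = T r + sum b {..<Suc r}"
    unfolding T_def by (rule suminf_split_initial_segment[OF b_summable])
  then show ?thesis using sum_nonneg[of "{..<Suc r}" b] b_nonneg by (simp add: A_def)
qed

lemma T_tendsto_0: "T \<longlonglongrightarrow> 0"
  using suminf_exist_split2[OF b_summable]
  unfolding T_def using LIMSEQ_Suc by fastforce

lemma abs_cov_le:
  fixes U V :: "'a \<Rightarrow> real"
  assumes "U \<in> borel_measurable (G {1..n})" "\<And>x. \<bar>U x\<bar> \<le> 1"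
    and "V \<in> borel_measurable (G {n + int k..})" "\<And>x. \<bar>V x\<bar> \<le> 1"
  shows "\<bar>cov U V\<bar> \<le> 4 * b k"
  by (rule abs_cov_real_le[OF subalgebra_G subalgebra_G assms mixing_b])

end

context centred_functional
begin

definition \<gamma> :: "int \<Rightarrow> int \<Rightarrow> real" where "\<gamma> i j = expectation (\<lambda>x. Y i x * Y j x)"

lemma YY_bounded: "\<bar>Y i x * Y j x\<bar> \<le> 1"
  using Y_bounded by (auto simp: abs_mult intro!: mult_le_one)

lemma YYYY_bounded: "\<bar>Y i x * Y i' x * (Y j x * Y j' x)\<bar> \<le> 1"
  using mult_mono[OF YY_bounded[of i x i'] YY_bounded[of j x j']] by (simp add: abs_mult)

lemma integrable_Y: "integrable P (Y i)"
  and integrable_YY: "integrable P (\<lambda>x. Y i x * Y j x)"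
  and integrable_YYYY: "integrable P (\<lambda>x. Y i x * Y i' x * (Y j x * Y j' x))"
  using Y_bounded YY_bounded YYYY_bounded by (auto intro!: integrable_bounded[where B=1])

lemma \<gamma>_sym: "\<gamma> i j = \<gamma> j i"
  by (simp add: \<gamma>_def mult.commute)

lemma \<gamma>_le_1: "\<bar>\<gamma> i j\<bar> \<le> 1"
  using norm_expectation_le[of "\<lambda>x. Y i x * Y j x" 1] YY_bounded by (simp add: \<gamma>_def)

lemma \<gamma>_le:
  assumes "1 \<le> i" "1 \<le> j"
  shows "\<bar>\<gamma> i j\<bar> \<le> 32 * b (nat \<bar>i - j\<bar>)"
  using abs_expectation_prod_list_le[of i "[j]" "nat \<bar>i - j\<bar>"] assms by (simp add: \<gamma>_def)

lemma \<gamma>_shift: "\<gamma> (i + k) (j + k) = \<gamma> i j"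
  unfolding \<gamma>_def Y_def by (rule integral_pair_stationary) measurable

text \<open>Growth is linear in the number of terms because every row of covariances is summable: 32
  from \<open>\<gamma>_le\<close>, times 2 for the two sides of \<open>i\<close>.\<close>

lemma second_moment_le:
  assumes J: "finite J" "\<And>j. j \<in> J \<Longrightarrow> 1 \<le> j"
  shows "expectation (\<lambda>x. (\<Sum>j\<in>J. Y j x)\<^sup>2) \<le> 64 * A * real (card J)"
proof -
  have "expectation (\<lambda>x. (\<Sum>j\<in>J. Y j x)\<^sup>2) = (\<Sum>i\<in>J. \<Sum>j\<in>J. \<gamma> i j)"
    by (simp add: power2_eq_square sum_product integrable_YY \<gamma>_def)
  also have "\<dots> \<le> (\<Sum>i\<in>J. 32 * (2 * A))"
  proof (rule sum_mono)
    fix i assume i: "i \<in> J"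
    have "(\<Sum>j\<in>J. \<gamma> i j) \<le> (\<Sum>j\<in>J. 32 * b (nat \<bar>i - j\<bar>))"
      using order.trans[OF abs_ge_self \<gamma>_le] J(2) i by (intro sum_mono) blast
    also have "\<dots> \<le> 32 * (2 * A)"
      unfolding sum_distrib_left[symmetric] A_def
      using sum_distance_le[OF b_summable b_nonneg J(1), of i] by simp
    finally show "(\<Sum>j\<in>J. \<gamma> i j) \<le> 32 * (2 * A)" .
  qed
  finally show ?thesis by (simp add: ac_simps)
qed

section \<open>Variance of the windowed quadratic form\<close>

definition Z :: "int \<Rightarrow> int \<Rightarrow> 'a \<Rightarrow> real" where "Z i i' x = Y i x * Y i' x - \<gamma> i i'"

lemma integrable_ZZ: "integrable P (\<lambda>x. Z i i' x * Z j j' x)"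
  unfolding Z_def left_diff_distrib right_diff_distrib
  by (intro Bochner_Integration.integrable_diff integrable_YYYY integrable_mult_left integrable_mult_right integrable_YY) auto

lemma expectation_ZZ:
  "expectation (\<lambda>x. Z i i' x * Z j j' x)
     = expectation (\<lambda>x. Y i x * Y i' x * (Y j x * Y j' x)) - \<gamma> i i' * \<gamma> j j'"
proof -
  have "(\<lambda>x. Z i i' x * Z j j' x) = (\<lambda>x. Y i x * Y i' x * (Y j x * Y j' x)
        - \<gamma> i i' * (Y j x * Y j' x) - \<gamma> j j' * (Y i x * Y i' x) + \<gamma> i i' * \<gamma> j j')"
    by (auto simp: Z_def algebra_simps)
  then show ?thesis
    by (simp add: integrable_YYYY integrable_YY prob_space flip: \<gamma>_def)
qed

text \<open>If one of four indices is far from the other three, it decouples, whichever side these lie on.\<close>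

lemma expectation_ZZ_near:
  assumes "1 \<le> i" "1 \<le> i'" "1 \<le> j" "1 \<le> j'"
  shows "\<bar>expectation (\<lambda>x. Z i i' x * Z j j' x)\<bar>
     \<le> 64 * (b (nat \<bar>i - i'\<bar>) + b (nat \<bar>i - j\<bar>) + b (nat \<bar>i - j'\<bar>))"
proof -
  define l where "l = min (nat \<bar>i - i'\<bar>) (min (nat \<bar>i - j\<bar>) (nat \<bar>i - j'\<bar>))"
  have l: "l \<le> nat \<bar>i - i'\<bar>" "l \<le> nat \<bar>i - j\<bar>" "l \<le> nat \<bar>i - j'\<bar>"
    unfolding l_def by linarith+
  have "\<bar>expectation (\<lambda>x. Y i x * prod_list (map (\<lambda>k. Y k x) [i', j, j']))\<bar> \<le> 32 * b l"
    by (rule abs_expectation_prod_list_le) (use assms l in \<open>auto simp: le_nat_iff\<close>)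
  then have "\<bar>expectation (\<lambda>x. Y i x * Y i' x * (Y j x * Y j' x))\<bar> \<le> 32 * b l"
    by (simp add: ac_simps)
  moreover have "b l \<le> b (nat \<bar>i - i'\<bar>) + b (nat \<bar>i - j\<bar>) + b (nat \<bar>i - j'\<bar>)"
    using b_nonneg[of "nat \<bar>i - i'\<bar>"] b_nonneg[of "nat \<bar>i - j\<bar>"] b_nonneg[of "nat \<bar>i - j'\<bar>"]
    by (auto simp: l_def min_def)
  moreover have "\<bar>\<gamma> i i' * \<gamma> j j'\<bar> \<le> 32 * b (nat \<bar>i - i'\<bar>) * 1"
    unfolding abs_mult using assms by (intro mult_mono \<gamma>_le \<gamma>_le_1) (auto simp: b_nonneg)
  ultimately show ?thesis unfolding expectation_ZZ
    using b_nonneg[of "nat \<bar>i - i'\<bar>"] b_nonneg[of "nat \<bar>i - j\<bar>"] b_nonneg[of "nat \<bar>i - j'\<bar>"]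
    by argo
qed

text \<open>The index \<open>i'\<close> is at most \<open>i + m\<close> and \<open>j'\<close> is at
  least \<open>j - m\<close>, so the two products live on blocks separated by
  \<open>j - i - 2 * m\<close>, and their covariance is bounded directly.\<close>

lemma expectation_ZZ_far_less:
  assumes "1 \<le> i" "1 \<le> i'" "1 \<le> j" "1 \<le> j'"
    and "\<bar>i - i'\<bar> \<le> int m" "\<bar>j - j'\<bar> \<le> int m" "i + 2 * int m < j"
  shows "\<bar>expectation (\<lambda>x. Z i i' x * Z j j' x)\<bar> \<le> 4 * b (nat \<bar>i - j\<bar> - 2 * m)"
proof -
  have "expectation (\<lambda>x. Z i i' x * Z j j' x) = cov (\<lambda>x. Y i x * Y i' x) (\<lambda>x. Y j x * Y j' x)"
    by (simp add: expectation_ZZ cov_def \<gamma>_def)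
  also have "\<bar>\<dots>\<bar> \<le> 4 * b (nat \<bar>i - j\<bar> - 2 * m)"
  proof (rule abs_cov_le[where n = "i + int m"])
    show "(\<lambda>x. Y i x * Y i' x) \<in> borel_measurable (G {1..i + int m})"
      using assms by (intro borel_measurable_times Y_measurable_G) auto
    show "(\<lambda>x. Y j x * Y j' x) \<in> borel_measurable (G {i + int m + int (nat \<bar>i - j\<bar> - 2 * m)..})"
      using assms by (intro borel_measurable_times Y_measurable_G) auto
  qed (rule YY_bounded)+
  finally show ?thesis .
qed

lemma expectation_ZZ_far:
  assumes "1 \<le> i" "1 \<le> i'" "1 \<le> j" "1 \<le> j'"
    and "\<bar>i - i'\<bar> \<le> int m" "\<bar>j - j'\<bar> \<le> int m" "2 * int m < \<bar>i - j\<bar>"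
  shows "\<bar>expectation (\<lambda>x. Z i i' x * Z j j' x)\<bar> \<le> 4 * b (nat \<bar>i - j\<bar> - 2 * m)"
proof (cases "i < j")
  case True
  then show ?thesis using assms by (intro expectation_ZZ_far_less) auto
next
  case False
  have "\<bar>expectation (\<lambda>x. Z j j' x * Z i i' x)\<bar> \<le> 4 * b (nat \<bar>j - i\<bar> - 2 * m)"
    using assms False by (intro expectation_ZZ_far_less) auto
  then show ?thesis by (simp add: abs_minus_commute mult.commute)
qed

text \<open>Clipping to {1..n} is what causes the boundary terms in
  \<open>expectation_Q_close\<close>.\<close>

definition W :: "nat \<Rightarrow> nat \<Rightarrow> int \<Rightarrow> int set" where
  "W n m j = {i\<in>{1..int n}. \<bar>j - i\<bar> \<le> int m}"

lemma finite_W[simp]: "finite (W n m j)"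
  unfolding W_def by (rule finite_subset[of _ "{1..int n}"]) auto

lemma card_W_le: "real (card (W n m j)) \<le> 2 * real m + 1"
proof -
  have "card (W n m j) \<le> card {j - int m..j + int m}"
    by (intro card_mono) (auto simp: W_def)
  then show ?thesis by simp
qed

lemma sum_W_le:
  assumes "\<And>i. i \<in> W n m j \<Longrightarrow> h i \<le> c" "0 \<le> c"
  shows "sum h (W n m j) \<le> (2 * real m + 1) * c"
proof -
  have "sum h (W n m j) \<le> real (card (W n m j)) * c"
    using assms by (intro sum_bounded_above) auto
  also have "\<dots> \<le> (2 * real m + 1) * c"
    using assms card_W_le by (intro mult_right_mono) auto
  finally show ?thesis .
qed

lemma sum_b_le: "finite J \<Longrightarrow> (\<Sum>j\<in>J. b (nat \<bar>i - j\<bar>)) \<le> 2 * A"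
  unfolding A_def by (rule sum_distance_le[OF b_summable b_nonneg])

text \<open>The exponent 2 is decisive. There are of order w^3 terms with \<open>j\<close> near
  \<open>i\<close>; in each of the three summands of the near bound, summing \<open>b\<close> over
  one index removes a factor w. For \<open>j\<close> far from \<open>i\<close> the sum over
  \<open>j\<close> converges, which leaves the w^2 choices of \<open>i'\<close> and
  \<open>j'\<close>.\<close>

lemma sum_ZZ_le:
  fixes n m :: nat
  assumes i: "i \<in> {1..int n}"
  defines "w \<equiv> 2 * real m + 1"
  shows "(\<Sum>i'\<in>W n m i. \<Sum>j\<in>{1..int n}. \<Sum>j'\<in>W n m j. \<bar>expectation (\<lambda>x. Z i i' x * Z j j' x)\<bar>)
     \<le> 640 * A * w\<^sup>2"
proof -
  let ?N = "{1..int n}" and ?E = "\<lambda>i' j j'. \<bar>expectation (\<lambda>x. Z i i' x * Z j j' x)\<bar>"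
  \<comment> \<open>Beyond distance 2m the windows around \<open>i\<close> and \<open>j\<close> are
    disjoint, which is where the far bound takes over.\<close>
  let ?near = "W n (2 * m) i" and ?far = "?N - W n (2 * m) i"
  have w: "1 \<le> w" by (simp add: w_def)
  have cn: "real (card ?near) \<le> 2 * w"
    using card_W_le[of n "2 * m" i] by (simp add: w_def)
  have A0: "0 \<le> A" using A_ge_1 by simp
  have near: "(\<Sum>j\<in>?near. \<Sum>j'\<in>W n m j. ?E i' j j')
       \<le> 64 * (2 * w * w * b (nat \<bar>i - i'\<bar>) + 4 * A * w)" if i': "i' \<in> W n m i" for i'
  proof -
    have "(\<Sum>j\<in>?near. \<Sum>j'\<in>W n m j. ?E i' j j')
      \<le> (\<Sum>j\<in>?near. \<Sum>j'\<in>W n m j. 64 * (b (nat \<bar>i - i'\<bar>) + b (nat \<bar>i - j\<bar>) + b (nat \<bar>i - j'\<bar>)))"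
      using i i' by (intro sum_mono expectation_ZZ_near) (auto simp: W_def)
    also have "\<dots> = 64 * ((\<Sum>j\<in>?near. \<Sum>j'\<in>W n m j. b (nat \<bar>i - i'\<bar>))
        + (\<Sum>j\<in>?near. \<Sum>j'\<in>W n m j. b (nat \<bar>i - j\<bar>)) + (\<Sum>j\<in>?near. \<Sum>j'\<in>W n m j. b (nat \<bar>i - j'\<bar>)))"
      by (simp only: sum_distrib_left[symmetric] sum.distrib)
    also have "\<dots> \<le> 64 * (2 * w * w * b (nat \<bar>i - i'\<bar>) + 2 * A * w + 2 * A * w)"
    proof (intro mult_left_mono add_mono)
      have "(\<Sum>j\<in>?near. \<Sum>j'\<in>W n m j. b (nat \<bar>i - i'\<bar>)) \<le> real (card ?near) * (w * b (nat \<bar>i - i'\<bar>))"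
        unfolding w_def by (intro sum_bounded_above sum_W_le) (auto simp: b_nonneg)
      also have "\<dots> \<le> 2 * w * (w * b (nat \<bar>i - i'\<bar>))"
        using cn w by (intro mult_right_mono) (auto simp: b_nonneg)
      finally show "(\<Sum>j\<in>?near. \<Sum>j'\<in>W n m j. b (nat \<bar>i - i'\<bar>)) \<le> 2 * w * w * b (nat \<bar>i - i'\<bar>)"
        by (simp add: mult.assoc)
      have "(\<Sum>j\<in>?near. \<Sum>j'\<in>W n m j. b (nat \<bar>i - j\<bar>)) \<le> (\<Sum>j\<in>?near. w * b (nat \<bar>i - j\<bar>))"
        unfolding w_def by (intro sum_mono sum_W_le) (auto simp: b_nonneg)
      also have "\<dots> \<le> w * (2 * A)"
        unfolding sum_distrib_left[symmetric] using w by (intro mult_left_mono sum_b_le) auto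
      finally show "(\<Sum>j\<in>?near. \<Sum>j'\<in>W n m j. b (nat \<bar>i - j\<bar>)) \<le> 2 * A * w"
        by (simp add: mult.commute)
      \<comment> \<open>Here \<open>b\<close> involves only the inner index. The range of
        \<open>j\<close> is enlarged to \<open>?N\<close> and the sums are exchanged, using that the
        window relation is symmetric.\<close>
      have "(\<Sum>j\<in>?near. \<Sum>j'\<in>W n m j. b (nat \<bar>i - j'\<bar>))
          \<le> (\<Sum>j\<in>?N. \<Sum>j'\<in>W n m j. b (nat \<bar>i - j'\<bar>))"
        by (intro sum_mono2) (auto simp: W_def b_nonneg intro!: sum_nonneg)
      also have "\<dots> = (\<Sum>j'\<in>?N. \<Sum>j\<in>{j\<in>?N. \<bar>j - j'\<bar> \<le> int m}. b (nat \<bar>i - j'\<bar>))"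
        unfolding W_def by (rule sum.swap_restrict) auto
      also have "\<dots> = (\<Sum>j'\<in>?N. \<Sum>j\<in>W n m j'. b (nat \<bar>i - j'\<bar>))"
        by (intro sum.cong) (auto simp: W_def)
      also have "\<dots> \<le> (\<Sum>j'\<in>?N. w * b (nat \<bar>i - j'\<bar>))"
        unfolding w_def by (intro sum_mono sum_W_le) (auto simp: b_nonneg)
      also have "\<dots> \<le> w * (2 * A)"
        unfolding sum_distrib_left[symmetric] using w by (intro mult_left_mono sum_b_le) auto
      finally show "(\<Sum>j\<in>?near. \<Sum>j'\<in>W n m j. b (nat \<bar>i - j'\<bar>)) \<le> 2 * A * w"
        by (simp add: mult.commute)
    qed simp
    finally show ?thesis by (simp add: ac_simps)
  qed
  have far: "(\<Sum>j\<in>?far. \<Sum>j'\<in>W n m j. ?E i' j j') \<le> 4 * (2 * A * w)" if i': "i' \<in> W n m i" for i'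
  proof -
    have "(\<Sum>j\<in>?far. \<Sum>j'\<in>W n m j. ?E i' j j') \<le> (\<Sum>j\<in>?far. w * (4 * b (nat \<bar>i - j\<bar> - 2 * m)))"
      unfolding w_def using i i'
      by (intro sum_mono sum_W_le expectation_ZZ_far) (auto simp: W_def b_nonneg)
    also have "\<dots> = 4 * w * (\<Sum>j\<in>?far. b (nat \<bar>i - j\<bar> - 2 * m))"
      by (simp add: sum_distrib_left ac_simps)
    also have "\<dots> \<le> 4 * w * (2 * A)"
      unfolding A_def using w
      by (intro mult_left_mono sum_shifted_distance_le[OF b_summable b_nonneg]) (auto simp: W_def)
    finally show ?thesis by (simp add: ac_simps)
  qed
  have "(\<Sum>i'\<in>W n m i. \<Sum>j\<in>?N. \<Sum>j'\<in>W n m j. ?E i' j j')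
      = (\<Sum>i'\<in>W n m i. (\<Sum>j\<in>?near. \<Sum>j'\<in>W n m j. ?E i' j j') + (\<Sum>j\<in>?far. \<Sum>j'\<in>W n m j. ?E i' j j'))"
    by (intro sum.cong refl, subst sum.subset_diff[of ?near ?N]) (auto simp: W_def)
  also have "\<dots> \<le> (\<Sum>i'\<in>W n m i. 64 * (2 * w * w * b (nat \<bar>i - i'\<bar>) + 4 * A * w) + 4 * (2 * A * w))"
    by (intro sum_mono add_mono near far)
  also have "\<dots> = 128 * w\<^sup>2 * (\<Sum>i'\<in>W n m i. b (nat \<bar>i - i'\<bar>)) + real (card (W n m i)) * (264 * A * w)"
    by (simp add: sum.distrib sum_distrib_left power2_eq_square algebra_simps)
  also have "\<dots> \<le> 128 * w\<^sup>2 * (2 * A) + w * (264 * A * w)"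
    using A0 w card_W_le[of n m i] unfolding w_def
    by (intro add_mono mult_left_mono mult_right_mono sum_b_le) auto
  also have "\<dots> = 520 * (A * w\<^sup>2)" by (simp add: power2_eq_square)
  \<comment> \<open>The near terms contribute 256 + 256 and the far terms 8; 640 is a rounding
    up.\<close>
  also have "\<dots> \<le> 640 * (A * w\<^sup>2)" using A0 by (intro mult_right_mono) auto
  finally show ?thesis by (simp add: mult.assoc)
qed

text \<open>This is \<open>sqrt n\<close> times the sum of \<open>Y j * L j\<close>, so
  \<open>Q n m / n\<close> is the random coefficient of the linear Taylor term and an empirical
  version of \<open>sigma2\<close>.\<close>

definition Q :: "nat \<Rightarrow> nat \<Rightarrow> 'a \<Rightarrow> real" where
  "Q n m x = (\<Sum>j\<in>{1..int n}. \<Sum>i\<in>W n m j. Y j x * Y i x)"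

lemma expectation_Q: "expectation (Q n m) = (\<Sum>j\<in>{1..int n}. \<Sum>i\<in>W n m j. \<gamma> j i)"
  by (simp add: Q_def[abs_def] \<gamma>_def integrable_YY)

lemma variance_Q_le:
  "expectation (\<lambda>x. (Q n m x - expectation (Q n m))\<^sup>2) \<le> 640 * A * (2 * real m + 1)\<^sup>2 * real n"
proof -
  let ?S = "Sigma {1..int n} (W n m)"
  have "Q n m x - expectation (Q n m) = (\<Sum>(i, i')\<in>?S. Z i i' x)" for x
    by (simp add: Q_def expectation_Q Z_def sum.Sigma[symmetric] sum_subtractf)
  then have "expectation (\<lambda>x. (Q n m x - expectation (Q n m))\<^sup>2)
     = expectation (\<lambda>x. \<Sum>(i, i')\<in>?S. \<Sum>(j, j')\<in>?S. Z i i' x * Z j j' x)"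
    by (simp add: power2_eq_square sum_product split_beta)
  also have "\<dots> = (\<Sum>(i, i')\<in>?S. \<Sum>(j, j')\<in>?S. expectation (\<lambda>x. Z i i' x * Z j j' x))"
    by (simp add: split_beta integrable_ZZ)
  also have "\<dots> \<le> (\<Sum>(i, i')\<in>?S. \<Sum>(j, j')\<in>?S. \<bar>expectation (\<lambda>x. Z i i' x * Z j j' x)\<bar>)"
    by (intro sum_mono) (auto intro!: sum_mono)
  also have "\<dots> = (\<Sum>i\<in>{1..int n}. \<Sum>i'\<in>W n m i. \<Sum>j\<in>{1..int n}. \<Sum>j'\<in>W n m j. \<bar>expectation (\<lambda>x. Z i i' x * Z j j' x)\<bar>)"
    by (simp add: sum.Sigma[symmetric])
  also have "\<dots> \<le> real (card {1..int n}) * (640 * A * (2 * real m + 1)\<^sup>2)"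
    by (intro sum_bounded_above sum_ZZ_le)
  finally show ?thesis by (simp add: ac_simps)
qed

section \<open>The long-run variance\<close>

definition g :: "nat \<Rightarrow> real" where "g d = \<gamma> 1 (1 + int d)"

text \<open>The two-sided sum of autocovariances, folded by symmetry. The base index 1 in
  \<open>g\<close> keeps all indices in the range of the mixing bounds. Nonnegativity is not visible
  from the series and is derived only after the limit of the characteristic functions is
  known.\<close>

definition sigma2 :: real where "sigma2 = g 0 + 2 * (\<Sum>d. g (Suc d))"

lemma \<gamma>_eq_g: "\<gamma> i j = g (nat \<bar>i - j\<bar>)"
proof -
  have *: "\<gamma> i j = g (nat \<bar>i - j\<bar>)" if "i \<le> j" for i j
    using \<gamma>_shift[of 1 "i - 1" "1 + (j - i)"] that by (simp add: g_def)
  show ?thesis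
  proof (cases "i \<le> j")
    case False
    then show ?thesis using *[of j i] \<gamma>_sym[of i j] by (simp add: abs_minus_commute)
  qed (rule *)
qed

lemma abs_g_le: "\<bar>g d\<bar> \<le> 32 * b d"
  using \<gamma>_le[of 1 "1 + int d"] by (simp add: g_def)

lemma g_tail: "\<bar>(\<Sum>d. g (Suc d)) - (\<Sum>d<r. g (Suc d))\<bar> \<le> 32 * T r"
proof -
  have s32: "summable (\<lambda>d. 32 * b (d + k))" for k by (rule summable_mult[OF summable_b_shift])
  have s: "summable (\<lambda>d. \<bar>g (d + k)\<bar>)" for k
    by (rule summable_comparison_test'[OF s32[of k]]) (use abs_g_le in auto)
  have sg: "summable (\<lambda>d. g (d + k))" for k using s[of k] by (rule summable_rabs_cancel)
  have "(\<Sum>d. g (Suc d)) = (\<Sum>d. g (d + Suc r)) + (\<Sum>d<r. g (Suc d))"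
    using suminf_split_initial_segment[OF sg[of 1], of r] by simp
  moreover have "\<bar>\<Sum>d. g (d + Suc r)\<bar> \<le> (\<Sum>d. \<bar>g (d + Suc r)\<bar>)" by (rule summable_rabs[OF s])
  moreover have "(\<Sum>d. \<bar>g (d + Suc r)\<bar>) \<le> (\<Sum>d. 32 * b (d + Suc r))"
    by (rule suminf_le[OF abs_g_le s s32])
  moreover have "(\<Sum>d. 32 * b (d + Suc r)) = 32 * T r"
    unfolding T_def by (rule suminf_mult[OF summable_b_shift])
  ultimately show ?thesis by linarith
qed

lemma T_min_le: "T (min m k) \<le> T m + (if k < m then A else 0)"
  using T_le_A[of k] T_nonneg[of m] by (auto simp: min_def)

text \<open>An unclipped window truncates the two-sided series at lag \<open>m\<close>. Near an end
  of {1..n} one side is cut earlier, at the distance to that end; this explains the minima.\<close>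

lemma sum_W_\<gamma>:
  assumes j: "j \<in> {1..int n}"
  shows "\<bar>(\<Sum>i\<in>W n m j. \<gamma> j i) - sigma2\<bar> \<le> 32 * (T (min m (nat (int n - j))) + T (min m (nat (j - 1))))"
proof -
  define r1 where "r1 = min m (nat (int n - j))"
  define r2 where "r2 = min m (nat (j - 1))"
  let ?R = "(\<lambda>d. j + 1 + int d) ` {..<r1}" and ?L = "(\<lambda>d. j - 1 - int d) ` {..<r2}"
  have W: "W n m j = {j} \<union> (?R \<union> ?L)"
  proof (intro set_eqI iffI)
    fix i assume "i \<in> W n m j"
    then have i: "1 \<le> i" "i \<le> int n" "\<bar>j - i\<bar> \<le> int m" by (auto simp: W_def)
    consider "i = j" | "i > j" | "i < j" by linarith
    then show "i \<in> {j} \<union> (?R \<union> ?L)"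
    proof cases
      case 2
      then have "i = j + 1 + int (nat (i - j - 1))" "nat (i - j - 1) < r1" using i by (auto simp: r1_def)
      then show ?thesis by blast
    next
      case 3
      then have "i = j - 1 - int (nat (j - i - 1))" "nat (j - i - 1) < r2" using i by (auto simp: r2_def)
      then show ?thesis by blast
    qed simp
  next
    fix i assume "i \<in> {j} \<union> (?R \<union> ?L)"
    then show "i \<in> W n m j" using j by (auto simp: W_def r1_def r2_def)
  qed
  have "(\<Sum>i\<in>W n m j. \<gamma> j i) = \<gamma> j j + (sum (\<gamma> j) ?R + sum (\<gamma> j) ?L)"
    unfolding W by (subst sum.union_disjoint, simp, simp, force, subst sum.union_disjoint) auto
  also have "\<gamma> j j = g 0" by (simp add: \<gamma>_eq_g)
  also have "sum (\<gamma> j) ?R = (\<Sum>d<r1. g (Suc d))"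
    by (subst sum.reindex) (auto simp: inj_on_def \<gamma>_eq_g nat_add_distrib intro!: sum.cong)
  also have "sum (\<gamma> j) ?L = (\<Sum>d<r2. g (Suc d))"
    by (subst sum.reindex) (auto simp: inj_on_def \<gamma>_eq_g nat_add_distrib intro!: sum.cong)
  finally show ?thesis
    using g_tail[of r1] g_tail[of r2] unfolding sigma2_def r1_def r2_def by argo
qed

text \<open>At each end at most \<open>m\<close> indices have a clipped window, and each of them
  costs at most \<open>A\<close> on top of the regular tail \<open>T m\<close>.\<close>

lemma expectation_Q_close:
  "\<bar>expectation (Q n m) - real n * sigma2\<bar> \<le> 64 * (real n * T m + real m * A)"
proof -
  let ?N = "{1..int n}"
  \<comment> \<open>The map \<open>k\<close> stands for the distance to either end; by injectivity
    at most \<open>m\<close> indices have \<open>k j < m\<close>.\<close>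
  have le: "(\<Sum>j\<in>?N. T (min m (k j))) \<le> real n * T m + real m * A"
    if k: "inj_on k ?N" for k :: "int \<Rightarrow> nat"
  proof -
    have "(\<Sum>j\<in>?N. T (min m (k j))) \<le> (\<Sum>j\<in>?N. T m + (if k j < m then A else 0))"
      by (intro sum_mono T_min_le)
    also have "\<dots> = real n * T m + real (card {j\<in>?N. k j < m}) * A"
      by (simp add: sum.distrib sum.If_cases Int_def)
    also have "card {j\<in>?N. k j < m} \<le> card {..<m}"
      by (rule card_inj_on_le[of k]) (use k in \<open>auto simp: inj_on_def\<close>)
    finally show ?thesis using A_ge_1 by (auto simp: mult_right_mono)
  qed
  have "\<bar>expectation (Q n m) - real n * sigma2\<bar> = \<bar>\<Sum>j\<in>?N. (\<Sum>i\<in>W n m j. \<gamma> j i) - sigma2\<bar>"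
    by (simp add: expectation_Q sum_subtractf)
  also have "\<dots> \<le> (\<Sum>j\<in>?N. 32 * (T (min m (nat (int n - j))) + T (min m (nat (j - 1)))))"
    by (intro order.trans[OF sum_abs] sum_mono sum_W_\<gamma>)
  also have "\<dots> = 32 * ((\<Sum>j\<in>?N. T (min m (nat (int n - j)))) + (\<Sum>j\<in>?N. T (min m (nat (j - 1)))))"
    by (simp add: sum_distrib_left sum.distrib)
  also have "\<dots> \<le> 32 * ((real n * T m + real m * A) + (real n * T m + real m * A))"
    by (intro mult_left_mono add_mono le) (auto simp: inj_on_def)
  finally show ?thesis by simp
qed

end

subsection \<open>The central limit theorem\<close>

lemma norm_iexp_minus_linear_le: "norm (iexp x - 1 - \<i> * complex_of_real x) \<le> x\<^sup>2 / 2"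
  using iexp_approx1[of x 1] by (simp add: numeral_2_eq_2 diff_diff_eq)

text \<open>The Cauchy-Schwarz estimate in additive form. The free \<open>c\<close> is to be taken
  as the expected size of \<open>U\<close>, which avoids square roots of second moments.\<close>

lemma (in prob_space) expectation_abs_le:
  fixes U :: "'a \<Rightarrow> real"
  assumes "integrable M U" "integrable M (\<lambda>x. (U x)\<^sup>2)" "0 < c"
  shows "expectation (\<lambda>x. \<bar>U x\<bar>) \<le> (expectation (\<lambda>x. (U x)\<^sup>2) / c + c) / 2"
proof -
  have "\<bar>u\<bar> \<le> (u\<^sup>2 / c + c) / 2" for u :: real
  proof -
    have "2 * \<bar>u\<bar> * c \<le> u\<^sup>2 + c\<^sup>2" using sum_squares_bound[of "\<bar>u\<bar>" c] by simp
    then show ?thesis using assms(3) by (simp add: field_simps power2_eq_square)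
  qed
  then have "expectation (\<lambda>x. \<bar>U x\<bar>) \<le> expectation (\<lambda>x. ((U x)\<^sup>2 / c + c) / 2)"
    using assms by (intro integral_mono) auto
  also have "\<dots> = (expectation (\<lambda>x. (U x)\<^sup>2) / c + c) / 2"
    using assms by (simp add: prob_space)
  finally show ?thesis .
qed

context mixing_process
begin

text \<open>For a fixed tolerance \<open>e\<close> the window can be proportional to
  \<open>sqrt n\<close>, so no sequence of windows with m / sqrt n -> 0 has to be
  constructed.\<close>

lemma ex_window:
  assumes "0 < e"
  shows "\<forall>\<^sub>F n in sequentially. \<exists>m. sqrt (real n) * b m \<le> e \<and> (2 * real m + 1) / sqrt (real n) \<le> e \<and> T m \<le> e"
proof -
  \<comment> \<open>With \<open>c = e / 4\<close> the term 2m uses up half of the allowance e * sqrt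
    n; the other half absorbs the + 1.\<close>
  define c where "c = e / 4"
  have c: "0 < c" using assms by (simp add: c_def)
  define m where "m n = nat \<lfloor>c * sqrt (real n)\<rfloor>" for n :: nat
  have sq: "filterlim (\<lambda>n. sqrt (real n)) at_top sequentially"
    by (rule filterlim_compose[OF sqrt_at_top filterlim_real_sequentially])
  have mlim: "filterlim m sequentially sequentially"
  proof -
    have "filterlim (\<lambda>n. c * sqrt (real n)) at_top sequentially"
      by (rule filterlim_tendsto_pos_mult_at_top[OF tendsto_const c sq])
    then show ?thesis unfolding m_def
      by (intro filterlim_compose[OF filterlim_nat_sequentially] filterlim_compose[OF filterlim_floor_sequentially])
  qed
  have "(\<lambda>n. real (m n) * b (m n)) \<longlonglongrightarrow> 0"
    by (rule filterlim_compose[OF antimono_summable_imp_mult_tendsto_0[OF b_summable b_antimono b_nonneg] mlim])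
  then have "\<forall>\<^sub>F n in sequentially. real (m n) * b (m n) < c * e / 2"
    by (rule order_tendstoD) (use c assms in simp)
  moreover have "\<forall>\<^sub>F n in sequentially. T (m n) < e"
    by (rule order_tendstoD[OF filterlim_compose[OF T_tendsto_0 mlim]]) (use assms in simp)
  \<comment> \<open>The bound 2 / c makes c * sqrt n at least 2, so the floor loses at most half of
    it; the bound 2 / e makes 1 at most e * sqrt n / 2.\<close>
  moreover have "\<forall>\<^sub>F n in sequentially. 2 / c + 2 / e + 1 \<le> sqrt (real n)"
    using sq by (simp add: filterlim_at_top)
  ultimately show ?thesis
  proof eventually_elim
    case (elim n)
    let ?s = "sqrt (real n)"
    have "0 < 2 / c" "0 < 2 / e" using c assms by auto
    then have s: "0 < ?s" "2 / c \<le> ?s" "2 / e \<le> ?s" using elim(3) by linarith+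
    have m: "real (m n) \<le> c * ?s" "c * ?s - 1 \<le> real (m n)"
      unfolding m_def using c by (auto simp: of_nat_nat)
    have "2 \<le> c * ?s" using s(2) c by (simp add: field_simps)
    then have "c * ?s / 2 \<le> real (m n)" using m by linarith
    then have "c * ?s / 2 * b (m n) \<le> real (m n) * b (m n)" by (intro mult_right_mono b_nonneg)
    with elim(1) have "c / 2 * (?s * b (m n)) \<le> c / 2 * e" by (simp add: algebra_simps)
    then have 1: "?s * b (m n) \<le> e" using c by (subst (asm) mult_le_cancel_left_pos) auto
    have "2 * real (m n) + 1 \<le> 2 * c * ?s + e * ?s / 2"
      using m s(3) assms by (simp add: field_simps)
    also have "\<dots> = e * ?s" by (simp add: c_def)
    finally have "(2 * real (m n) + 1) / ?s \<le> e" using s by (simp add: field_simps)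
    with 1 elim(2) show ?case by (auto intro!: exI[of _ "m n"])
  qed
qed

end

context centred_functional
begin

definition S :: "nat \<Rightarrow> 'a \<Rightarrow> real" where
  "S n x = (\<Sum>j\<in>{1..int n}. Y j x) / sqrt (real n)"

definition L :: "nat \<Rightarrow> nat \<Rightarrow> int \<Rightarrow> 'a \<Rightarrow> real" where
  "L n m j x = (\<Sum>i\<in>W n m j. Y i x) / sqrt (real n)"

definition \<phi> :: "nat \<Rightarrow> real \<Rightarrow> complex" where
  "\<phi> n t = expectation (\<lambda>x. iexp (t * S n x))"

text \<open>The derivative of \<open>\<phi>\<close> taken under the integral sign;
  \<open>\<phi>_has_vector_derivative\<close> justifies the exchange.\<close>

definition D :: "nat \<Rightarrow> real \<Rightarrow> complex" where
  "D n t = expectation (\<lambda>x. \<i> * S n x * iexp (t * S n x))"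

lemma S_measurable[measurable]: "S n \<in> borel_measurable P"
  unfolding S_def by measurable

lemma L_measurable[measurable]: "L n m j \<in> borel_measurable P"
  unfolding L_def by measurable

lemma Q_measurable[measurable]: "Q n m \<in> borel_measurable P"
  unfolding Q_def by measurable

lemma abs_sum_Y_le: "\<bar>\<Sum>j\<in>J. Y j x\<bar> \<le> real (card J)"
  using order.trans[OF sum_abs sum_bounded_above[of J "\<lambda>j. \<bar>Y j x\<bar>" 1]] Y_bounded by simp

lemma S_bounded: "\<bar>S n x\<bar> \<le> sqrt (real n)"
proof -
  have "\<bar>S n x\<bar> = \<bar>\<Sum>j\<in>{1..int n}. Y j x\<bar> / sqrt (real n)" by (simp add: S_def abs_divide)
  also have "\<dots> \<le> real n / sqrt (real n)" using abs_sum_Y_le[of x "{1..int n}"] by (intro divide_right_mono) auto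
  also have "\<dots> = sqrt (real n)" by (simp add: real_div_sqrt)
  finally show ?thesis .
qed

text \<open>Removing the window leaves one block before and one block after \<open>j\<close>, both
  further than \<open>m\<close> away. The exponential of their sum is a product, so the sandwich
  estimate applies with \<open>Y j\<close> in the middle.\<close>

lemma expectation_remote_le:
  assumes j: "j \<in> {1..int n}"
  shows "norm (expectation (\<lambda>x. Y j x * iexp (t * (S n x - L n m j x)))) \<le> 32 * b m"
proof -
  define u where "u x = (\<Sum>i\<in>{i\<in>{1..int n}. i < j - int m}. Y i x) / sqrt (real n)" for x
  define v where "v x = (\<Sum>i\<in>{i\<in>{1..int n}. j + int m < i}. Y i x) / sqrt (real n)" for x
  have fin: "finite {i\<in>{1..int n}. R i}" for R
    by (rule finite_subset[of _ "{1..int n}"]) auto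
  have N: "{1..int n} = {i\<in>{1..int n}. i < j - int m} \<union> ({i\<in>{1..int n}. j + int m < i} \<union> W n m j)"
    by (auto simp: W_def)
  have "(\<Sum>i\<in>{1..int n}. Y i x) = (\<Sum>i\<in>{i\<in>{1..int n}. i < j - int m}. Y i x)
       + (\<Sum>i\<in>{i\<in>{1..int n}. j + int m < i} \<union> W n m j. Y i x)" for x
    by (subst N, rule sum.union_disjoint[OF fin finite_UnI[OF fin finite_W]]) (auto simp: W_def)
  moreover have "(\<Sum>i\<in>{i\<in>{1..int n}. j + int m < i} \<union> W n m j. Y i x)
       = (\<Sum>i\<in>{i\<in>{1..int n}. j + int m < i}. Y i x) + (\<Sum>i\<in>W n m j. Y i x)" for x
    by (rule sum.union_disjoint[OF fin finite_W]) (auto simp: W_def)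
  ultimately have uv: "S n x - L n m j x = u x + v x" for x
    by (simp add: S_def L_def u_def v_def add_divide_distrib)
  have "norm (expectation (\<lambda>x. iexp (t * u x) * complex_of_real (Y j x) * iexp (t * v x))) \<le> 32 * b m"
  proof (rule norm_expectation_sandwich_le)
    have [measurable]: "u \<in> borel_measurable (G {1..j - int m})"
      unfolding u_def by (intro borel_measurable_divide borel_measurable_sum Y_measurable_G) auto
    show "(\<lambda>x. iexp (t * u x)) \<in> borel_measurable (G {1..j - int m})" by measurable
    have [measurable]: "v \<in> borel_measurable (G {j + int m..})"
      unfolding v_def by (intro borel_measurable_divide borel_measurable_sum Y_measurable_G) auto
    show "(\<lambda>x. iexp (t * v x)) \<in> borel_measurable (G {j + int m..})" by measurable
    show "(\<lambda>x. complex_of_real (Y j x)) \<in> borel_measurable (G {j})"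
      by (auto intro!: complex_of_real_measurable Y_measurable_G)
  qed (use j in \<open>auto simp: Y_bounded Y_centred\<close>)
  also have "(\<lambda>x. iexp (t * u x) * complex_of_real (Y j x) * iexp (t * v x))
      = (\<lambda>x. Y j x * iexp (t * (S n x - L n m j x)))"
    by (simp add: uv distrib_left exp_add ac_simps)
  finally show ?thesis .
qed

lemma L_bounded: "\<bar>L n m j x\<bar> \<le> (2 * real m + 1) / sqrt (real n)"
  unfolding L_def abs_divide
  using order.trans[OF abs_sum_Y_le card_W_le] by (auto intro!: divide_right_mono)

lemma L_second_moment: "expectation (\<lambda>x. (L n m j x)\<^sup>2) \<le> 64 * A * (2 * real m + 1) / real n"
proof -
  have "expectation (\<lambda>x. (L n m j x)\<^sup>2) = expectation (\<lambda>x. (\<Sum>i\<in>W n m j. Y i x)\<^sup>2) / real n"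
    by (simp add: L_def power_divide)
  also have "\<dots> \<le> 64 * A * real (card (W n m j)) / real n"
    by (intro divide_right_mono second_moment_le finite_W) (auto simp: W_def)
  also have "\<dots> \<le> 64 * A * (2 * real m + 1) / real n"
    using A_ge_1 card_W_le[of n m j] by (intro divide_right_mono mult_left_mono) auto
  finally show ?thesis .
qed

text \<open>Pure algebra at a fixed \<open>x\<close>: with exp (i t (S - L)) = exp (i t S) exp (- i
  t L), the second sum cancels everything in the first except the constant and linear Taylor terms.
  These sum to the \<open>S\<close> term and the \<open>Q\<close> term on the left.\<close>

lemma stein_identity:
  fixes t :: real
  assumes n: "0 < n"
  shows "\<i> * S n x * iexp (t * S n x) + t * (Q n m x / real n) * iexp (t * S n x)
    = (\<Sum>j\<in>{1..int n}. \<i> / sqrt (real n) * (Y j x * iexp (t * (S n x - L n m j x))))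
      + (\<Sum>j\<in>{1..int n}. - \<i> / sqrt (real n) * (Y j x * iexp (t * S n x) *
           (iexp (- t * L n m j x) - 1 - \<i> * complex_of_real (- t * L n m j x))))"
proof -
  let ?e = "iexp (t * S n x)" and ?s = "sqrt (real n)"
  have e: "iexp (t * (S n x - L n m j x)) = ?e * iexp (- t * L n m j x)" for j
    by (simp add: exp_add[symmetric] algebra_simps)
  have "(\<Sum>j\<in>{1..int n}. \<i> / ?s * (Y j x * iexp (t * (S n x - L n m j x))))
      + (\<Sum>j\<in>{1..int n}. - \<i> / ?s * (Y j x * ?e *
           (iexp (- t * L n m j x) - 1 - \<i> * complex_of_real (- t * L n m j x))))
     = (\<Sum>j\<in>{1..int n}. \<i> * ?e * complex_of_real (Y j x / ?s) + t * ?e * complex_of_real (Y j x * L n m j x / ?s))"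
    unfolding sum.distrib[symmetric] e by (intro sum.cong refl) (simp add: field_simps)
  also have "\<dots> = \<i> * ?e * complex_of_real (\<Sum>j\<in>{1..int n}. Y j x / ?s)
       + t * ?e * complex_of_real (\<Sum>j\<in>{1..int n}. Y j x * L n m j x / ?s)"
    by (simp add: sum.distrib sum_distrib_left)
  also have "(\<Sum>j\<in>{1..int n}. Y j x / ?s) = S n x" by (simp add: S_def sum_divide_distrib)
  also have "(\<Sum>j\<in>{1..int n}. Y j x * L n m j x / ?s) = Q n m x / real n"
    using n by (simp add: L_def Q_def sum_divide_distrib[symmetric] sum_distrib_left[symmetric])
  finally show ?thesis by (simp add: ac_simps)
qed

lemma Q_integrable: "integrable P (Q n m)"
  unfolding Q_def by (auto intro!: Bochner_Integration.integrable_sum integrable_YY)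

lemma Q_bounded: "\<exists>K. \<forall>x. \<bar>Q n m x\<bar> \<le> K"
proof -
  have "\<bar>Q n m x\<bar> \<le> (\<Sum>j\<in>{1..int n}. \<Sum>i\<in>W n m j. 1)" for x
    unfolding Q_def by (intro order.trans[OF sum_abs] sum_mono order.trans[OF sum_abs] YY_bounded)
  then show ?thesis by blast
qed

lemma expectation_Q_deviation_le:
  assumes n: "0 < n"
  shows "expectation (\<lambda>x. \<bar>Q n m x - expectation (Q n m)\<bar>) \<le> 640 * A * (2 * real m + 1) * sqrt (real n)"
proof -
  let ?U = "\<lambda>x. Q n m x - expectation (Q n m)" and ?w = "2 * real m + 1"
  obtain K where K: "\<And>x. \<bar>Q n m x\<bar> \<le> K" using Q_bounded by blast
  have i: "integrable P ?U" using Q_integrable by simp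
  have i2: "integrable P (\<lambda>x. (?U x)\<^sup>2)"
  proof (rule integrable_bounded)
    show "norm ((?U x)\<^sup>2) \<le> (K + \<bar>expectation (Q n m)\<bar>)\<^sup>2" for x
      using K[of x] by (auto simp: abs_le_square_iff[symmetric])
  qed measurable
  \<comment> \<open>The choice c = (2m + 1) * sqrt n has the order of the bound for the standard
    deviation of \<open>Q\<close> in \<open>variance_Q_le\<close>.\<close>
  have "expectation (\<lambda>x. \<bar>?U x\<bar>) \<le> (expectation (\<lambda>x. (?U x)\<^sup>2) / (?w * sqrt (real n)) + ?w * sqrt (real n)) / 2"
    by (rule expectation_abs_le[OF i i2]) (use n in simp)
  also have "\<dots> \<le> (640 * A * ?w\<^sup>2 * real n / (?w * sqrt (real n)) + ?w * sqrt (real n)) / 2"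
    using variance_Q_le by (intro divide_right_mono add_mono) auto
  also have "640 * A * ?w\<^sup>2 * real n / (?w * sqrt (real n)) = 640 * A * ?w * sqrt (real n)"
  proof -
    have "640 * A * ?w\<^sup>2 * real n = 640 * A * ?w * sqrt (real n) * (?w * sqrt (real n))"
    proof -
      have "640 * A * ?w\<^sup>2 * real n = 640 * A * ?w\<^sup>2 * (sqrt (real n) * sqrt (real n))" by simp
      also have "\<dots> = 640 * A * ?w * sqrt (real n) * (?w * sqrt (real n))"
        by (simp only: power2_eq_square ac_simps)
      finally show ?thesis .
    qed
    moreover have "?w * sqrt (real n) \<noteq> 0" using n by (simp add: add_nonneg_eq_0_iff)
    ultimately show ?thesis by (metis nonzero_divide_eq_eq)
  qed
  also have "(640 * A * ?w * sqrt (real n) + ?w * sqrt (real n)) / 2 \<le> 640 * A * ?w * sqrt (real n)"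
    using A_ge_1 mult_right_mono[of 1 "640 * A" "?w * sqrt (real n)"] by (simp add: algebra_simps)
  finally show ?thesis .
qed

text \<open>The constant 704 is 640 for the fluctuation of \<open>Q\<close> around its mean plus 64
  for the boundary effect in that mean, where m / n is at most (2m + 1) / sqrt n.\<close>

lemma expectation_Q_sigma2_le:
  assumes n: "0 < n"
  shows "expectation (\<lambda>x. \<bar>sigma2 - Q n m x / real n\<bar>)
    \<le> 64 * T m + 704 * A * ((2 * real m + 1) / sqrt (real n))"
proof -
  let ?E = "expectation (Q n m)" and ?w = "2 * real m + 1"
  have "\<bar>sigma2 - Q n m x / real n\<bar> \<le> (\<bar>Q n m x - ?E\<bar> + \<bar>?E - real n * sigma2\<bar>) / real n" for x
  proof -
    have "\<bar>sigma2 - Q n m x / real n\<bar> = \<bar>real n * sigma2 - Q n m x\<bar> / real n"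
    proof -
      have "sigma2 - Q n m x / real n = (real n * sigma2 - Q n m x) / real n"
        using n by (simp add: field_simps)
      then show ?thesis by (simp add: abs_divide)
    qed
    also have "\<dots> \<le> (\<bar>Q n m x - ?E\<bar> + \<bar>?E - real n * sigma2\<bar>) / real n"
      by (intro divide_right_mono) auto
    finally show ?thesis .
  qed
  then have "expectation (\<lambda>x. \<bar>sigma2 - Q n m x / real n\<bar>)
     \<le> expectation (\<lambda>x. (\<bar>Q n m x - ?E\<bar> + \<bar>?E - real n * sigma2\<bar>) / real n)"
    using Q_integrable by (intro integral_mono) auto
  also have "\<dots> = (expectation (\<lambda>x. \<bar>Q n m x - ?E\<bar>) + \<bar>?E - real n * sigma2\<bar>) / real n"
    using Q_integrable by (simp add: prob_space)
  also have "\<dots> \<le> (640 * A * ?w * sqrt (real n) + 64 * (real n * T m + real m * A)) / real n"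
    using expectation_Q_close expectation_Q_deviation_le[OF n] by (intro divide_right_mono add_mono) auto
  also have "\<dots> = 64 * T m + 640 * A * (?w / sqrt (real n)) + 64 * A * (real m / real n)"
  proof -
    have s: "sqrt (real n) / real n = 1 / sqrt (real n)" using n by (simp add: field_simps)
    have "(640 * A * ?w * sqrt (real n) + 64 * (real n * T m + real m * A)) / real n
        = 640 * A * ?w * (sqrt (real n) / real n) + 64 * T m + 64 * A * (real m / real n)"
      using n by (simp add: add_divide_distrib distrib_left)
    then show ?thesis unfolding s by simp
  qed
  also have "\<dots> \<le> 64 * T m + 640 * A * (?w / sqrt (real n)) + 64 * A * (?w / sqrt (real n))"
  proof -
    have "real m / real n \<le> ?w / sqrt (real n)"
      using n by (intro frac_le) (auto intro: real_le_lsqrt simp: power2_eq_square)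
    then show ?thesis using A_ge_1 by (intro add_left_mono mult_left_mono) auto
  qed
  finally have "expectation (\<lambda>x. \<bar>sigma2 - Q n m x / real n\<bar>)
     \<le> 64 * T m + 640 * A * (?w / sqrt (real n)) + 64 * A * (?w / sqrt (real n))" .
  moreover have "a + 640 * A * r + 64 * A * r = a + 704 * A * r" for a r by simp
  ultimately show ?thesis by (simp only:)
qed

text \<open>The three summands are, in order, the dependence between \<open>Y j\<close> and the
  remote part, the quadratic Taylor remainder, and the replacement of \<open>Q n m / n\<close> by
  \<open>sigma2\<close>.\<close>

lemma stein_bound:
  fixes t :: real
  assumes n: "0 < n"
  shows "norm (D n t + t * sigma2 * \<phi> n t) \<le> 32 * (sqrt (real n) * b m)
     + 32 * A * t\<^sup>2 * ((2 * real m + 1) / sqrt (real n))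
     + \<bar>t\<bar> * (64 * T m + 704 * A * ((2 * real m + 1) / sqrt (real n)))"
proof -
  let ?N = "{1..int n}" and ?s = "sqrt (real n)" and ?w = "2 * real m + 1"
  let ?e = "\<lambda>x. iexp (t * S n x)"
  define F where "F j x = Y j x * iexp (t * (S n x - L n m j x))" for j x
  define H where "H j x = Y j x * ?e x * (iexp (- t * L n m j x) - 1 - \<i> * complex_of_real (- t * L n m j x))" for j x
  have iF: "integrable P (F j)" for j
    unfolding F_def by (rule integrable_bounded[where B=1]) (auto simp: norm_mult Y_bounded)
  have Hb: "norm (H j x) \<le> t\<^sup>2 / 2 * (L n m j x)\<^sup>2" for j x
  proof -
    have "norm (H j x) \<le> 1 * 1 * ((- t * L n m j x)\<^sup>2 / 2)"
      unfolding H_def norm_mult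
      by (intro mult_mono norm_iexp_minus_linear_le) (auto simp: Y_bounded)
    then show ?thesis by (simp add: power_mult_distrib)
  qed
  have iL: "integrable P (\<lambda>x. (L n m j x)\<^sup>2)" for j
    by (rule integrable_bounded[where B="(?w / ?s)\<^sup>2"])
       (use L_bounded in \<open>auto simp: abs_le_square_iff[symmetric]\<close>)
  have iH: "integrable P (H j)" for j
  proof (rule Bochner_Integration.integrable_bound)
    show "integrable P (\<lambda>x. t\<^sup>2 / 2 * (L n m j x)\<^sup>2)" using iL by simp
    show "H j \<in> borel_measurable P" unfolding H_def by measurable
  qed (use Hb in auto)
  have iS: "integrable P (\<lambda>x. \<i> * S n x * ?e x)"
    by (rule integrable_bounded[where B="?s"]) (auto simp: norm_mult S_bounded)
  have ie: "integrable P ?e" by (rule integrable_bounded[where B=1]) auto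
  obtain K where K: "\<And>x. \<bar>Q n m x\<bar> \<le> K" using Q_bounded by blast
  have iQ: "integrable P (\<lambda>x. (Q n m x / real n) * ?e x)"
    by (rule integrable_bounded[where B="K / real n"])
       (use K in \<open>auto simp: norm_mult norm_divide intro!: divide_right_mono\<close>)
  define q where "q x = complex_of_real (Q n m x / real n) * ?e x" for x
  have iq: "integrable P q" unfolding q_def using iQ by simp
  have q1: "(\<lambda>x. \<i> * S n x * ?e x + t * (Q n m x / real n) * ?e x) = (\<lambda>x. \<i> * S n x * ?e x + t * q x)"
    by (simp add: q_def mult.assoc)
  have q2: "(\<lambda>x. complex_of_real (sigma2 - Q n m x / real n) * ?e x) = (\<lambda>x. sigma2 * ?e x - q x)"
    by (simp add: q_def left_diff_distrib)
  have E1: "expectation (\<lambda>x. \<i> * S n x * ?e x + t * (Q n m x / real n) * ?e x)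
      = D n t + t * expectation q"
    unfolding q1 D_def using iS iq
    by (subst Bochner_Integration.integral_add) (auto simp del: of_real_mult)
  have E2: "expectation (\<lambda>x. complex_of_real (sigma2 - Q n m x / real n) * ?e x)
      = sigma2 * \<phi> n t - expectation q"
    unfolding q2 \<phi>_def using ie iq
    by (subst Bochner_Integration.integral_diff) (auto simp del: of_real_mult)
  have split: "D n t + t * sigma2 * \<phi> n t
     = expectation (\<lambda>x. \<i> * S n x * ?e x + t * (Q n m x / real n) * ?e x)
       + t * expectation (\<lambda>x. complex_of_real (sigma2 - Q n m x / real n) * ?e x)"
    unfolding E1 E2 by (simp add: right_diff_distrib mult.assoc)
  have 1: "expectation (\<lambda>x. \<i> * S n x * ?e x + t * (Q n m x / real n) * ?e x)
     = (\<Sum>j\<in>?N. \<i> / ?s * expectation (F j)) + (\<Sum>j\<in>?N. - \<i> / ?s * expectation (H j))"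
    unfolding stein_identity[OF n, of _ t m] F_def[symmetric] H_def[symmetric]
    using iF iH by simp
  have 2: "norm (\<Sum>j\<in>?N. \<i> / ?s * expectation (F j)) \<le> 32 * (?s * b m)"
  proof -
    have "norm (\<Sum>j\<in>?N. \<i> / ?s * expectation (F j)) \<le> (\<Sum>j\<in>?N. 1 / ?s * (32 * b m))"
      unfolding F_def using expectation_remote_le
      by (intro sum_norm_le) (auto simp: norm_mult norm_divide intro!: divide_right_mono)
    also have "\<dots> = (real n / ?s) * (32 * b m)" by simp
    also have "\<dots> = 32 * (?s * b m)" by (simp add: real_div_sqrt)
    finally show ?thesis .
  qed
  have 3: "norm (\<Sum>j\<in>?N. - \<i> / ?s * expectation (H j)) \<le> 32 * A * t\<^sup>2 * (?w / ?s)"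
  proof -
    have "norm (expectation (H j)) \<le> t\<^sup>2 / 2 * (64 * A * ?w / real n)" for j
    proof -
      have "norm (expectation (H j)) \<le> expectation (\<lambda>x. norm (H j x))" by (rule integral_norm_bound)
      also have "\<dots> \<le> expectation (\<lambda>x. t\<^sup>2 / 2 * (L n m j x)\<^sup>2)"
        using iH iL Hb by (intro integral_mono) auto
      also have "\<dots> = t\<^sup>2 / 2 * expectation (\<lambda>x. (L n m j x)\<^sup>2)" using iL by simp
      also have "\<dots> \<le> t\<^sup>2 / 2 * (64 * A * ?w / real n)"
        by (intro mult_left_mono L_second_moment) auto
      finally show ?thesis .
    qed
    then have "norm (\<Sum>j\<in>?N. - \<i> / ?s * expectation (H j)) \<le> (\<Sum>j\<in>?N. 1 / ?s * (t\<^sup>2 / 2 * (64 * A * ?w / real n)))"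
      by (intro sum_norm_le, unfold norm_mult, intro mult_mono) (auto simp: norm_divide)
    also have "\<dots> = 32 * A * t\<^sup>2 * (?w / ?s)" using n by (simp add: field_simps)
    finally show ?thesis .
  qed
  have "norm (expectation (\<lambda>x. complex_of_real (sigma2 - Q n m x / real n) * ?e x))
      \<le> expectation (\<lambda>x. norm (complex_of_real (sigma2 - Q n m x / real n) * ?e x))"
    by (rule integral_norm_bound)
  also have "\<dots> = expectation (\<lambda>x. \<bar>sigma2 - Q n m x / real n\<bar>)"
    by (simp add: norm_mult del: of_real_diff of_real_divide)
  also have "\<dots> \<le> 64 * T m + 704 * A * (?w / ?s)" by (rule expectation_Q_sigma2_le[OF n])
  finally have 4: "norm (t * expectation (\<lambda>x. complex_of_real (sigma2 - Q n m x / real n) * ?e x))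
      \<le> \<bar>t\<bar> * (64 * T m + 704 * A * (?w / ?s))"
    unfolding norm_mult by (intro mult_mono) auto
  show ?thesis unfolding split 1
    by (intro norm_triangle_le add_mono 2 3 4)
qed

section \<open>The differential inequality for the characteristic function\<close>

lemma \<phi>_has_vector_derivative: "(\<phi> n has_vector_derivative D n t) (at t)"
  unfolding has_vector_derivative_def has_derivative_at
proof (intro conjI)
  show "bounded_linear (\<lambda>h. h *\<^sub>R D n t)" by (rule bounded_linear_scaleR_left)
  \<comment> \<open>Since \<open>S n\<close> is bounded by \<open>sqrt n\<close>, the second-order
    Taylor remainder is at most n * h^2 / 2 uniformly in \<open>x\<close>, so the bound survives
    integration.\<close>
  have key: "norm (\<phi> n (t + h) - \<phi> n t - h *\<^sub>R D n t) \<le> real n / 2 * h\<^sup>2" for h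
  proof -
    let ?R = "\<lambda>x. iexp ((t + h) * S n x) - iexp (t * S n x) - h *\<^sub>R (\<i> * S n x * iexp (t * S n x))"
    have i: "integrable P (\<lambda>x. iexp (u * S n x))" for u
      by (rule integrable_bounded[where B=1]) auto
    have j: "integrable P (\<lambda>x. \<i> * S n x * iexp (t * S n x))"
      by (rule integrable_bounded[where B="sqrt (real n)"]) (auto simp: norm_mult S_bounded)
    have "\<phi> n (t + h) - \<phi> n t - h *\<^sub>R D n t = expectation ?R"
      unfolding \<phi>_def D_def using i j by (simp del: of_real_mult of_real_add)
    also have "norm \<dots> \<le> real n / 2 * h\<^sup>2"
    proof (rule norm_expectation_le)
      fix x
      have "?R x = iexp (t * S n x) * (iexp (h * S n x) - 1 - \<i> * complex_of_real (h * S n x))"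
        by (simp add: algebra_simps exp_add[symmetric] scaleR_conv_of_real)
      then have "norm (?R x) \<le> (h * S n x)\<^sup>2 / 2"
        using norm_iexp_minus_linear_le[of "h * S n x"] by (simp add: norm_mult)
      also have "\<dots> \<le> real n / 2 * h\<^sup>2"
      proof -
        have "(S n x)\<^sup>2 \<le> real n" using S_bounded[of n x] by (simp add: sqrt_ge_absD)
        then show ?thesis using mult_right_mono[of "(S n x)\<^sup>2" "real n" "h\<^sup>2"] by (simp add: power_mult_distrib algebra_simps)
      qed
      finally show "norm (?R x) \<le> real n / 2 * h\<^sup>2" .
    qed measurable
    finally show ?thesis .
  qed
  show "((\<lambda>h. norm (\<phi> n (t + h) - \<phi> n t - h *\<^sub>R D n t) / norm h) \<longlongrightarrow> 0) (at 0)"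
  proof (rule Lim_null_comparison)
    show "\<forall>\<^sub>F h in at 0. norm (norm (\<phi> n (t + h) - \<phi> n t - h *\<^sub>R D n t) / norm h) \<le> real n / 2 * \<bar>h\<bar>"
      using key by (auto intro!: always_eventually simp: divide_le_eq power2_eq_square mult.assoc)
    show "((\<lambda>h. real n / 2 * \<bar>h\<bar>) \<longlongrightarrow> 0) (at 0)"
      by (auto intro!: tendsto_eq_intros)
  qed
qed

lemma \<phi>_zero: "\<phi> n 0 = 1"
  by (simp add: \<phi>_def prob_space)

text \<open>Multiplying by the integrating factor \<open>E u\<close> makes the left-hand side of the
  hypothesis the derivative of \<open>\<psi>\<close>, and \<open>\<psi> 0 = 1\<close>. The absolute
  value of \<open>sigma2\<close> appears because its sign is not yet known.\<close>

lemma \<phi>_close: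
  fixes t :: real
  assumes bound: "\<And>u. \<bar>u\<bar> \<le> \<bar>t\<bar> \<Longrightarrow> norm (D n u + u * sigma2 * \<phi> n u) \<le> B"
  shows "norm (\<phi> n t - exp (- (sigma2 * t\<^sup>2 / 2))) \<le> exp (- (sigma2 * t\<^sup>2 / 2)) * (exp (\<bar>sigma2\<bar> * t\<^sup>2 / 2) * B * \<bar>t\<bar>)"
proof -
  define E where "E u = exp (sigma2 * u\<^sup>2 / 2)" for u
  define \<psi> where "\<psi> u = E u *\<^sub>R \<phi> n u" for u
  have B0: "0 \<le> B" using bound[of 0] norm_ge_zero order.trans by (metis abs_ge_zero abs_zero)
  have dE: "(E has_real_derivative E u * (sigma2 * u)) (at u)" for u
    unfolding E_def by (auto intro!: derivative_eq_intros)
  have d\<psi>: "(\<psi> has_vector_derivative E u *\<^sub>R (D n u + u * sigma2 * \<phi> n u)) (at u)" for u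
  proof -
    have "(\<psi> has_vector_derivative E u *\<^sub>R D n u + (E u * (sigma2 * u)) *\<^sub>R \<phi> n u) (at u)"
      unfolding \<psi>_def by (rule has_vector_derivative_scaleR[OF dE \<phi>_has_vector_derivative])
    then show ?thesis by (simp add: scaleR_conv_of_real algebra_simps)
  qed
  have "norm (\<psi> t - \<psi> 0) \<le> exp (\<bar>sigma2\<bar> * t\<^sup>2 / 2) * B * norm (t - 0)"
  proof (rule differentiable_bound)
    \<comment> \<open>The symmetric interval covers both signs of \<open>t\<close> at once.\<close>
    show "convex {-\<bar>t\<bar>..\<bar>t\<bar>}" by simp
    show "(\<psi> has_derivative (\<lambda>h. h *\<^sub>R (E u *\<^sub>R (D n u + u * sigma2 * \<phi> n u)))) (at u within {-\<bar>t\<bar>..\<bar>t\<bar>})" for u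
      using has_vector_derivative_at_within[OF d\<psi>] unfolding has_vector_derivative_def .
    fix u assume "u \<in> {-\<bar>t\<bar>..\<bar>t\<bar>}"
    then have u: "\<bar>u\<bar> \<le> \<bar>t\<bar>" by auto
    then have "u\<^sup>2 \<le> t\<^sup>2" by (simp add: abs_le_square_iff)
    then have "sigma2 * u\<^sup>2 \<le> \<bar>sigma2\<bar> * t\<^sup>2" by (intro mult_mono) auto
    then have "E u \<le> exp (\<bar>sigma2\<bar> * t\<^sup>2 / 2)" by (simp add: E_def)
    moreover have "0 \<le> E u" by (simp add: E_def)
    ultimately have V: "norm (E u *\<^sub>R (D n u + u * sigma2 * \<phi> n u)) \<le> exp (\<bar>sigma2\<bar> * t\<^sup>2 / 2) * B"
      unfolding norm_scaleR using bound[OF u] by (intro mult_mono) auto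
    show "onorm (\<lambda>h. h *\<^sub>R (E u *\<^sub>R (D n u + u * sigma2 * \<phi> n u))) \<le> exp (\<bar>sigma2\<bar> * t\<^sup>2 / 2) * B"
    proof (rule onorm_le)
      fix h :: real
      have "norm (h *\<^sub>R (E u *\<^sub>R (D n u + u * sigma2 * \<phi> n u)))
          = norm (E u *\<^sub>R (D n u + u * sigma2 * \<phi> n u)) * norm h"
        by (simp only: norm_scaleR real_norm_def ac_simps)
      also have "\<dots> \<le> exp (\<bar>sigma2\<bar> * t\<^sup>2 / 2) * B * norm h"
        by (rule mult_right_mono[OF V]) simp
      finally show "norm (h *\<^sub>R (E u *\<^sub>R (D n u + u * sigma2 * \<phi> n u))) \<le> exp (\<bar>sigma2\<bar> * t\<^sup>2 / 2) * B * norm h" .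
    qed
  qed auto
  moreover have "\<psi> 0 = 1" by (simp add: \<psi>_def E_def \<phi>_zero)
  moreover have "\<phi> n t - exp (- (sigma2 * t\<^sup>2 / 2)) = exp (- (sigma2 * t\<^sup>2 / 2)) *\<^sub>R (\<psi> t - 1)"
    by (simp add: \<psi>_def E_def scaleR_conv_of_real right_diff_distrib exp_minus field_simps flip: of_real_mult)
  ultimately show ?thesis by simp
qed

lemma \<phi>_tendsto: "(\<lambda>n. \<phi> n t) \<longlonglongrightarrow> exp (- (sigma2 * t\<^sup>2 / 2))"
proof (rule LIM_zero_cancel, rule tendsto_norm_zero_cancel, rule LIMSEQ_I)
  fix r :: real assume r: "0 < r"
  \<comment> \<open>The summand 1 keeps \<open>C\<close> positive when \<open>t = 0\<close>, so that
    division by it is harmless.\<close>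
  define C where "C = exp (- (sigma2 * t\<^sup>2 / 2)) * exp (\<bar>sigma2\<bar> * t\<^sup>2 / 2) * \<bar>t\<bar> * (32 + 32 * A * t\<^sup>2 + \<bar>t\<bar> * (64 + 704 * A)) + 1"
  have "0 \<le> C - 1" unfolding C_def using A_ge_1 by simp
  then have C: "0 < C" by linarith
  define e where "e = r / (2 * C)"
  have e: "0 < e" using r C by (simp add: e_def)
  from ex_window[OF e] eventually_gt_at_top[of 0]
  have "\<forall>\<^sub>F n in sequentially. norm (\<phi> n t - exp (- (sigma2 * t\<^sup>2 / 2))) < r"
  proof eventually_elim
    case (elim n)
    then obtain m where m: "sqrt (real n) * b m \<le> e" "(2 * real m + 1) / sqrt (real n) \<le> e" "T m \<le> e" by blast
    have "norm (D n u + u * sigma2 * \<phi> n u) \<le> (32 + 32 * A * t\<^sup>2 + \<bar>t\<bar> * (64 + 704 * A)) * e" if u: "\<bar>u\<bar> \<le> \<bar>t\<bar>" for u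
    proof -
      have "u\<^sup>2 \<le> t\<^sup>2" using u by (simp add: abs_le_square_iff)
      have "norm (D n u + u * sigma2 * \<phi> n u) \<le> 32 * (sqrt (real n) * b m)
         + 32 * A * u\<^sup>2 * ((2 * real m + 1) / sqrt (real n))
         + \<bar>u\<bar> * (64 * T m + 704 * A * ((2 * real m + 1) / sqrt (real n)))"
        by (rule stein_bound) (use elim in simp)
      also have "\<dots> \<le> 32 * e + 32 * A * t\<^sup>2 * e + \<bar>t\<bar> * (64 * e + 704 * A * e)"
        using m u \<open>u\<^sup>2 \<le> t\<^sup>2\<close> A_ge_1 e T_nonneg[of m] b_nonneg[of m] by (intro add_mono mult_mono) auto
      finally show ?thesis by (simp add: algebra_simps)
    qed
    from \<phi>_close[OF this]
    have "norm (\<phi> n t - exp (- (sigma2 * t\<^sup>2 / 2))) \<le> (C - 1) * e" by (simp add: C_def ac_simps)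
    also have "\<dots> < C * e" using e by simp
    also have "\<dots> = r / 2" using C by (simp add: e_def)
    also have "\<dots> < r" using r by simp
    finally show ?case .
  qed
  then show "\<exists>no. \<forall>n\<ge>no. norm (norm (\<phi> n t - exp (- (sigma2 * t\<^sup>2 / 2))) - 0) < r"
    by (simp add: eventually_sequentially)
qed

text \<open>A characteristic function cannot converge to a limit exceeding 1.\<close>

lemma sigma2_nonneg: "0 \<le> sigma2"
proof -
  have "norm (\<phi> n 1) \<le> 1" for n
    unfolding \<phi>_def by (rule norm_expectation_le) auto
  moreover have "(\<lambda>n. norm (\<phi> n 1)) \<longlonglongrightarrow> norm (complex_of_real (exp (- (sigma2 * 1\<^sup>2 / 2))))"
    using \<phi>_tendsto[of 1] by (intro tendsto_norm) (simp add: exp_of_real)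
  ultimately have "norm (complex_of_real (exp (- (sigma2 * 1\<^sup>2 / 2)))) \<le> 1"
    by (intro LIMSEQ_le_const2) auto
  then show ?thesis by simp
qed

end

subsection \<open>Quantiles\<close>

text \<open>The odd extension of the power function. For positive \<open>a\<close> it is a strictly
  increasing map of the line whose inverse has exponent 1 / a; it describes both the expansion of F
  and the limit law.\<close>

definition signed_powr :: "real \<Rightarrow> real \<Rightarrow> real" where
  "signed_powr a x = \<bar>x\<bar> powr a * sgn x"

lemma signed_powr_inverse:
  assumes "a > 0"
  shows "signed_powr a (signed_powr (1 / a) x) = x"
  using assms by (auto simp: signed_powr_def powr_powr sgn_if abs_mult)

lemma signed_powr_mult:
  assumes "0 \<le> c"
  shows "signed_powr a (c * x) = c powr a * signed_powr a x"
  using assms by (cases "c = 0") (simp_all add: signed_powr_def abs_mult powr_mult sgn_mult)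

lemma signed_powr_strict_mono:
  assumes "a > 0"
  shows "strict_mono (signed_powr a)"
proof (rule strict_monoI)
  fix x y :: real assume "x < y"
  then consider "0 \<le> x" | "x < 0" "0 \<le> y" | "y < 0" by linarith
  then show "signed_powr a x < signed_powr a y"
  proof cases
    case 1
    then show ?thesis using \<open>x < y\<close> assms powr_less_mono2[of a x y] by (cases "x = 0") (auto simp: signed_powr_def)
  next
    case 2
    then have "signed_powr a x < 0" "0 \<le> signed_powr a y"
      by (auto simp: signed_powr_def sgn_if)
    then show ?thesis by linarith
  next
    case 3
    then show ?thesis using \<open>x < y\<close> assms powr_less_mono2[of a "- y" "- x"] by (auto simp: signed_powr_def)
  qed
qed

text \<open>The Galois connection between a distribution function and its quantile: right continuity
  makes the infimum attained, while nonemptiness and boundedness make it a genuine infimum.\<close>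

lemma quantile_le_iff:
  fixes G :: "real \<Rightarrow> real"
  assumes mono: "mono G" and cont: "\<And>t. continuous (at_right t) G"
    and ne: "{t. p \<le> G t} \<noteq> {}" and bdd: "bdd_below {t. p \<le> G t}"
  shows "quantile G p \<le> x \<longleftrightarrow> p \<le> G x"
proof
  assume "p \<le> G x"
  then show "quantile G p \<le> x" unfolding quantile_def by (intro cInf_lower bdd) simp
next
  assume le: "quantile G p \<le> x"
  show "p \<le> G x"
  proof (rule ccontr)
    assume "\<not> p \<le> G x"
    then have "\<forall>\<^sub>F t in at_right x. G t < p"
      using cont[of x] by (intro order_tendstoD) (auto simp: continuous_within)
    then obtain c where c: "x < c" "\<And>t. x < t \<Longrightarrow> t < c \<Longrightarrow> G t < p"
      unfolding eventually_at_right_field by blast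
    \<comment> \<open>Monotonicity spreads \<open>G < p\<close> from the interval (x, c) to
      everything below \<open>c\<close>; the comparison point lies between \<open>max x t\<close>
      and \<open>c\<close>.\<close>
    have "c \<le> t" if "p \<le> G t" for t
    proof (rule ccontr)
      assume "\<not> c \<le> t"
      then have "G t \<le> G ((max x t + c) / 2)" by (intro monoD[OF mono]) auto
      moreover have "G ((max x t + c) / 2) < p" using c(1) \<open>\<not> c \<le> t\<close> by (intro c(2)) auto
      ultimately show False using that by linarith
    qed
    then have "c \<le> quantile G p" unfolding quantile_def using ne by (intro cInf_greatest) auto
    then show False using le c(1) by linarith
  qed
qed

lemma indicator_atMost_right_continuous:
  fixes y t0 :: real
  shows "((\<lambda>t. indicat_real {..t} y) \<longlongrightarrow> indicat_real {..t0} y) (at_right t0)"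
proof (rule tendsto_eventually)
  show "\<forall>\<^sub>F t in at_right t0. indicat_real {..t} y = indicat_real {..t0} y"
  proof (cases "y \<le> t0")
    case True
    show ?thesis using eventually_at_right_less[of t0] by eventually_elim (use True in auto)
  next
    case False
    then have "\<forall>\<^sub>F t in at_right t0. t < y" by (intro order_tendstoD(2)[OF tendsto_ident_at]) auto
    then show ?thesis by eventually_elim (use False in auto)
  qed
qed

lemma quantile_empirical_le_iff:
  assumes p: "0 < p" "p < 1" and n: "0 < n"
  shows "quantile (empirical_cdf X n \<omega>) p \<le> x \<longleftrightarrow> p \<le> empirical_cdf X n \<omega> x"
proof (rule quantile_le_iff)
  \<comment> \<open>The bound \<open>?B\<close> dominates all sample points in absolute value: the
    empirical distribution function is 1 at \<open>?B\<close> and 0 below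
    \<open>- ?B\<close>.\<close>
  let ?B = "\<Sum>i=1..n. \<bar>X (int i) \<omega>\<bar>"
  have B: "\<bar>X (int i) \<omega>\<bar> \<le> ?B" if "i \<in> {1..n}" for i
    using that by (intro member_le_sum) auto
  show "mono (empirical_cdf X n \<omega>)"
    unfolding empirical_cdf_def by (auto intro!: monoI divide_right_mono sum_mono split: split_indicator)
  show "continuous (at_right t) (empirical_cdf X n \<omega>)" for t
    unfolding continuous_within empirical_cdf_def
    using n by (intro tendsto_divide tendsto_sum indicator_atMost_right_continuous tendsto_const) auto
  have "empirical_cdf X n \<omega> ?B = (\<Sum>i=1..n. 1) / real n"
    unfolding empirical_cdf_def using B
    by (intro arg_cong2[where f="(/)"] sum.cong) (auto simp: abs_le_iff)
  then have "?B \<in> {t. p \<le> empirical_cdf X n \<omega> t}" using p n by simp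
  then show "{t. p \<le> empirical_cdf X n \<omega> t} \<noteq> {}" by blast
  show "bdd_below {t. p \<le> empirical_cdf X n \<omega> t}"
  proof (rule bdd_belowI)
    fix t assume "t \<in> {t. p \<le> empirical_cdf X n \<omega> t}"
    then have "empirical_cdf X n \<omega> t \<noteq> 0" using p by auto
    then have "(\<Sum>i=1..n. indicat_real {..t} (X (int i) \<omega>)) \<noteq> 0" by (auto simp: empirical_cdf_def)
    then obtain i where "i \<in> {1..n}" "indicat_real {..t} (X (int i) \<omega>) \<noteq> 0"
      by (meson sum.neutral)
    then show "- ?B \<le> t" using B[of i] by (auto simp: indicator_def abs_le_iff split: if_splits)
  qed
qed

lemma sum_int_eq: "(\<Sum>j\<in>{1..int n}. g j) = (\<Sum>i=1..n. g (int i))"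
proof -
  have "{1..int n} = int ` {1..n}" by (simp add: image_int_atLeastAtMost)
  then show ?thesis by (simp add: sum.reindex)
qed

text \<open>The sign in \<open>p - indicat_real\<close> turns the event into a lower half-line for
  the normalized sum, hence into a value of its distribution function.\<close>

lemma empirical_cdf_ge_iff:
  assumes n: "0 < n"
  shows "p \<le> empirical_cdf X n \<omega> t \<longleftrightarrow>
    (\<Sum>j\<in>{1..int n}. p - indicat_real {..t} (X j \<omega>)) / sqrt (real n) \<le> 0"
  using n unfolding empirical_cdf_def sum_int_eq
  by (simp add: sum_subtractf field_simps)

section \<open>Empirical process at a moving threshold\<close>

context mixing_process
begin

text \<open>Covariances within distance \<open>K\<close> are bounded by \<open>d\<close>, the others
  by mixing. The bound is uniform in n and depends on \<open>f\<close> only through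
  \<open>d\<close>, so \<open>f\<close> may later vary with n.\<close>

lemma normalized_sum_second_moment_le:
  assumes "f \<in> borel_measurable borel" "\<And>x. \<bar>f x\<bar> \<le> 1" "\<And>i. expectation (\<lambda>x. f (X i x)) = 0"
    and d: "\<And>i. expectation (\<lambda>x. \<bar>f (X i x)\<bar>) \<le> d"
  shows "expectation (\<lambda>x. ((\<Sum>j\<in>{1..int n}. f (X j x)) / sqrt (real n))\<^sup>2) \<le> (2 * real K + 1) * d + 64 * T K"
proof (cases "n = 0")
  case True
  have "0 \<le> d" using order.trans[OF Bochner_Integration.integral_nonneg d[of 0]] by simp
  then show ?thesis using True T_nonneg by simp
next
  case False
  interpret centred_functional P X f using assms by unfold_locales auto
  let ?N = "{1..int n}"
  have gd: "\<bar>\<gamma> i j\<bar> \<le> d" for i j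
  proof -
    have "\<bar>\<gamma> i j\<bar> \<le> expectation (\<lambda>x. \<bar>Y i x * Y j x\<bar>)" unfolding \<gamma>_def by (rule integral_abs_bound)
    also have "\<dots> \<le> expectation (\<lambda>x. \<bar>Y i x\<bar>)"
      by (intro integral_mono integrable_abs integrable_YY integrable_Y)
         (simp add: abs_mult mult_left_le Y_bounded)
    also have "\<dots> \<le> d" using d by (simp add: Y_def)
    finally show ?thesis .
  qed
  have d0: "0 \<le> d" using gd[of 0 0] by simp
  have row: "(\<Sum>j\<in>?N. \<gamma> i j) \<le> (2 * real K + 1) * d + 64 * T K" if i: "i \<in> ?N" for i
  proof -
    have "(\<Sum>j\<in>?N. \<gamma> i j) = (\<Sum>j\<in>?N - W n K i. \<gamma> i j) + (\<Sum>j\<in>W n K i. \<gamma> i j)"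
      by (rule sum.subset_diff) (auto simp: W_def)
    moreover have "(\<Sum>j\<in>W n K i. \<gamma> i j) \<le> (2 * real K + 1) * d"
      using gd d0 by (intro sum_W_le) (auto simp: abs_le_iff)
    moreover have "(\<Sum>j\<in>?N - W n K i. \<gamma> i j) \<le> 64 * T K"
    proof -
      \<comment> \<open>Outside the window the distance is at least \<open>Suc K\<close>, so
        subtracting and adding \<open>Suc K\<close> changes nothing; it exhibits the summand of
        \<open>T K\<close>.\<close>
      have "(\<Sum>j\<in>?N - W n K i. \<gamma> i j) \<le> (\<Sum>j\<in>?N - W n K i. 32 * b (nat \<bar>i - j\<bar> - Suc K + Suc K))"
      proof (rule sum_mono)
        fix j assume j: "j \<in> ?N - W n K i"
        then have "nat \<bar>i - j\<bar> - Suc K + Suc K = nat \<bar>i - j\<bar>" by (auto simp: W_def)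
        then show "\<gamma> i j \<le> 32 * b (nat \<bar>i - j\<bar> - Suc K + Suc K)"
          using order.trans[OF abs_ge_self \<gamma>_le[of i j]] i j by auto
      qed
      also have "\<dots> = 32 * (\<Sum>j\<in>?N - W n K i. b (nat \<bar>i - j\<bar> - Suc K + Suc K))"
        by (rule sum_distrib_left[symmetric])
      also have "\<dots> \<le> 32 * (2 * T K)"
        unfolding T_def
        by (intro mult_left_mono sum_shifted_distance_le[where c="\<lambda>d. b (d + Suc K)" and s="Suc K"] summable_b_shift b_nonneg)
           (auto simp: W_def)
      finally show ?thesis by simp
    qed
    ultimately show ?thesis by linarith
  qed
  have "expectation (\<lambda>x. (S n x)\<^sup>2) = (\<Sum>i\<in>?N. \<Sum>j\<in>?N. \<gamma> i j) / real n"
    by (simp add: S_def power_divide power2_eq_square[of "sum _ _"] sum_product integrable_YY \<gamma>_def)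
  also have "\<dots> \<le> (\<Sum>i\<in>?N. (2 * real K + 1) * d + 64 * T K) / real n"
    by (intro divide_right_mono sum_mono row) auto
  also have "\<dots> = (2 * real K + 1) * d + 64 * T K" using False by simp
  finally show ?thesis by (simp add: S_def Y_def)
qed

text \<open>The cutoff \<open>K\<close> is fixed first, to make the mixing tail small; only then is
  n taken large, to make (2K + 1) * d n small.\<close>

lemma normalized_sum_tendsto_0:
  assumes "\<And>n. f n \<in> borel_measurable borel" "\<And>n x. \<bar>f n x\<bar> \<le> 1" "\<And>n i. expectation (\<lambda>x. f n (X i x)) = 0"
    and d: "\<And>n i. expectation (\<lambda>x. \<bar>f n (X i x)\<bar>) \<le> d n" "d \<longlonglongrightarrow> 0"
  shows "(\<lambda>n. expectation (\<lambda>x. \<bar>(\<Sum>j\<in>{1..int n}. f n (X j x)) / sqrt (real n)\<bar>)) \<longlonglongrightarrow> 0"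
proof (rule LIMSEQ_I)
  fix r :: real assume r: "0 < r"
  note assms(1)[measurable]
  let ?U = "\<lambda>n x. (\<Sum>j\<in>{1..int n}. f n (X j x)) / sqrt (real n)"
  have U: "\<bar>?U n x\<bar> \<le> sqrt (real n)" for n x
  proof -
    have "\<bar>\<Sum>j\<in>{1..int n}. f n (X j x)\<bar> \<le> real n"
      using order.trans[OF sum_abs sum_bounded_above[of "{1..int n}" "\<lambda>j. \<bar>f n (X j x)\<bar>" 1]] assms(2) by simp
    then have "\<bar>?U n x\<bar> \<le> real n / sqrt (real n)"
      unfolding abs_divide by (auto intro!: divide_right_mono)
    then show ?thesis by (simp add: real_div_sqrt)
  qed
  have i: "integrable P (?U n)" for n by (rule integrable_bounded[OF _ ]) (use U in auto)
  have i2: "integrable P (\<lambda>x. (?U n x)\<^sup>2)" for n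
  proof (rule integrable_bounded)
    show "norm ((?U n x)\<^sup>2) \<le> real n" for x
      using U[of n x] by (simp add: sqrt_ge_absD)
  qed measurable
  have "\<forall>\<^sub>F K in sequentially. T K < r\<^sup>2 / 128"
    by (rule order_tendstoD[OF T_tendsto_0]) (use r in simp)
  then obtain K where K: "T K < r\<^sup>2 / 128" by (auto simp: eventually_sequentially)
  have "(\<lambda>n. (2 * real K + 1) * d n) \<longlonglongrightarrow> (2 * real K + 1) * 0" by (intro tendsto_intros d)
  then have "\<forall>\<^sub>F n in sequentially. (2 * real K + 1) * d n < r\<^sup>2 / 4"
    by (rule order_tendstoD) (use r in simp)
  then have "\<forall>\<^sub>F n in sequentially. norm (expectation (\<lambda>x. \<bar>?U n x\<bar>) - 0) < r"
  proof eventually_elim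
    case (elim n)
    have "expectation (\<lambda>x. (?U n x)\<^sup>2) \<le> (2 * real K + 1) * d n + 64 * T K"
      by (rule normalized_sum_second_moment_le) (use assms in auto)
    also have "\<dots> < r\<^sup>2" using elim K zero_less_power[OF r, of 2] by linarith
    finally have "expectation (\<lambda>x. (?U n x)\<^sup>2) < r * r" by (simp only: power2_eq_square[of r])
    then have "expectation (\<lambda>x. (?U n x)\<^sup>2) / r < r" by (simp only: pos_divide_less_eq[OF r])
    moreover have "u < r" if "v < r" "u \<le> (v + r) / 2" for u v using that by simp
    ultimately have "expectation (\<lambda>x. \<bar>?U n x\<bar>) < r"
      using expectation_abs_le[OF i i2 r, of n] by blast
    then show ?case by simp
  qed
  then show "\<exists>no. \<forall>n\<ge>no. norm (expectation (\<lambda>x. \<bar>?U n x\<bar>) - 0) < r"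
    by (simp add: eventually_sequentially)
qed

theorem bounded_mixing_clt:
  assumes "f \<in> borel_measurable borel" "\<And>x. \<bar>f x\<bar> \<le> 1" "\<And>i. expectation (\<lambda>x. f (X i x)) = 0"
  shows "\<exists>s\<ge>0. \<forall>t. (\<lambda>n. expectation (\<lambda>x. iexp (t * ((\<Sum>j\<in>{1..int n}. f (X j x)) / sqrt (real n)))))
     \<longlonglongrightarrow> complex_of_real (exp (- (s * t\<^sup>2 / 2)))"
proof -
  interpret centred_functional P X f using assms by unfold_locales auto
  show ?thesis
    using sigma2_nonneg \<phi>_tendsto unfolding \<phi>_def S_def Y_def by blast
qed

text \<open>Slutsky's lemma at the level of characteristic functions: the map y -> exp (i t y) has
  Lipschitz constant |t|, so a remainder vanishing in mean does not affect the limit.\<close>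

lemma expectation_iexp_perturb_le:
  fixes U R :: "'a \<Rightarrow> real"
  assumes [measurable]: "U \<in> borel_measurable P" "integrable P R"
  shows "norm (expectation (\<lambda>x. iexp (t * (U x + R x))) - expectation (\<lambda>x. iexp (t * U x)))
     \<le> \<bar>t\<bar> * expectation (\<lambda>x. \<bar>R x\<bar>)"
proof -
  have [measurable]: "R \<in> borel_measurable P" using assms by auto
  have i: "integrable P (\<lambda>x. iexp (t * (U x + R x)))" "integrable P (\<lambda>x. iexp (t * U x))"
    by (rule integrable_bounded[where B=1]; simp)+
  have "norm (expectation (\<lambda>x. iexp (t * (U x + R x))) - expectation (\<lambda>x. iexp (t * U x)))
     = norm (expectation (\<lambda>x. iexp (t * (U x + R x)) - iexp (t * U x)))"
    using i by (simp del: of_real_mult of_real_add)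
  also have "\<dots> \<le> expectation (\<lambda>x. norm (iexp (t * (U x + R x)) - iexp (t * U x)))"
    by (rule integral_norm_bound)
  also have "\<dots> \<le> expectation (\<lambda>x. \<bar>t\<bar> * \<bar>R x\<bar>)"
  proof (rule integral_mono)
    show "integrable P (\<lambda>x. norm (iexp (t * (U x + R x)) - iexp (t * U x)))"
      using i by (auto simp del: of_real_mult of_real_add)
    show "integrable P (\<lambda>x. \<bar>t\<bar> * \<bar>R x\<bar>)" using assms by auto
    fix x
    have "iexp (t * (U x + R x)) - iexp (t * U x) = iexp (t * U x) * (iexp (t * R x) - 1)"
      by (simp add: right_diff_distrib exp_add distrib_left)
    then have "norm (iexp (t * (U x + R x)) - iexp (t * U x)) = norm (iexp (t * R x) - 1)"
      by (simp add: norm_mult)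
    also have "\<dots> \<le> \<bar>t * R x\<bar>" using iexp_approx1[of "t * R x" 0] by simp
    finally show "norm (iexp (t * (U x + R x)) - iexp (t * U x)) \<le> \<bar>t\<bar> * \<bar>R x\<bar>" by (simp add: abs_mult)
  qed
  also have "\<dots> = \<bar>t\<bar> * expectation (\<lambda>x. \<bar>R x\<bar>)" by simp
  finally show ?thesis .
qed

end

text \<open>The exponent is the one for which the increment h_n satisfies |h_n|^\<rho> = |x|^\<rho>
  / sqrt n, which the factor \<open>sqrt n\<close> compensates.\<close>

lemma expansion_tendsto:
  fixes F :: "real \<Rightarrow> real" and t \<rho> M x :: real
  assumes \<rho>: "\<rho> > 0"
    and exp: "(\<lambda>h. F (t + h) - F t - M * \<bar>h\<bar> powr \<rho> * sgn h) \<in> o[at 0](\<lambda>h. \<bar>h\<bar> powr \<rho>)"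
  shows "(\<lambda>n. sqrt (real n) * (F (t + x * real n powr (- 1 / (2 * \<rho>))) - F t)) \<longlonglongrightarrow> M * signed_powr \<rho> x"
proof (cases "x = 0")
  \<comment> \<open>The expansion is a limit in punctured neighbourhoods of 0, so a vanishing
    increment needs its own case.\<close>
  case True
  then show ?thesis by (simp add: signed_powr_def)
next
  case x: False
  define h where "h n = x * real n powr (- 1 / (2 * \<rho>))" for n :: nat
  define r where "r u = F (t + u) - F t - M * \<bar>u\<bar> powr \<rho> * sgn u" for u
  have "(\<lambda>n. real n powr (- 1 / (2 * \<rho>))) \<longlonglongrightarrow> 0"
    using \<rho> by (intro tendsto_neg_powr filterlim_real_sequentially) auto
  then have "h \<longlonglongrightarrow> x * 0" unfolding h_def by (intro tendsto_intros)
  moreover have "\<forall>\<^sub>F n in sequentially. h n \<noteq> 0"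
    using eventually_gt_at_top[of 0] by eventually_elim (use x in \<open>auto simp: h_def\<close>)
  ultimately have h: "filterlim h (at 0) sequentially" by (intro filterlim_atI) auto
  have "((\<lambda>u. r u / \<bar>u\<bar> powr \<rho>) \<longlongrightarrow> 0) (at 0)"
    using exp unfolding r_def by (rule smalloD_tendsto)
  from filterlim_compose[OF this h]
  have "(\<lambda>n. M * signed_powr \<rho> x + r (h n) / \<bar>h n\<bar> powr \<rho> * \<bar>x\<bar> powr \<rho>)
      \<longlonglongrightarrow> M * signed_powr \<rho> x + 0 * \<bar>x\<bar> powr \<rho>"
    by (intro tendsto_intros)
  moreover have "\<forall>\<^sub>F n in sequentially. M * signed_powr \<rho> x + r (h n) / \<bar>h n\<bar> powr \<rho> * \<bar>x\<bar> powr \<rho>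
     = sqrt (real n) * (F (t + x * real n powr (- 1 / (2 * \<rho>))) - F t)"
    using eventually_gt_at_top[of 0]
  proof eventually_elim
    case (elim n)
    have "(real n powr (- 1 / (2 * \<rho>))) powr \<rho> = real n powr (- (1 / 2))"
      using \<rho> by (simp add: powr_powr)
    then have "\<bar>h n\<bar> powr \<rho> = \<bar>x\<bar> powr \<rho> * real n powr (- (1 / 2))"
      by (simp add: h_def abs_mult powr_mult)
    moreover have "real n powr (- (1 / 2)) = 1 / sqrt (real n)"
      using elim by (simp add: powr_minus powr_half_sqrt inverse_eq_divide)
    ultimately have hp: "\<bar>h n\<bar> powr \<rho> = \<bar>x\<bar> powr \<rho> / sqrt (real n)" by simp
    have sg: "sgn (h n) = sgn x" using elim by (simp add: h_def sgn_mult)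
    have "F (t + h n) - F t = r (h n) + M * (\<bar>x\<bar> powr \<rho> / sqrt (real n)) * sgn x"
      by (simp add: r_def hp sg)
    then have "sqrt (real n) * (F (t + h n) - F t) = sqrt (real n) * r (h n) + M * (\<bar>x\<bar> powr \<rho>) * sgn x"
      using elim by (simp add: field_simps)
    moreover have "r (h n) / \<bar>h n\<bar> powr \<rho> * \<bar>x\<bar> powr \<rho> = sqrt (real n) * r (h n)"
      using x by (simp add: hp)
    ultimately show ?case by (simp add: h_def signed_powr_def)
  qed
  ultimately show ?thesis by (simp add: filterlim_cong)
qed

lemma (in prob_space) expectation_indicator_atMost:
  assumes [measurable]: "U \<in> borel_measurable M"
  shows "expectation (\<lambda>x. indicat_real {..a} (U x)) = cdf (distr M borel U) a"
proof -
  have "expectation (\<lambda>x. indicat_real {..a} (U x)) = (\<integral>y. indicat_real {..a} y \<partial>distr M borel U)"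
    by (rule integral_distr[symmetric]) auto
  then show ?thesis by (simp add: cdf_def)
qed

lemma (in prob_space) expectation_indicator_diff:
  assumes [measurable]: "U \<in> borel_measurable M"
  shows "expectation (\<lambda>x. \<bar>indicat_real {..a} (U x) - indicat_real {..c} (U x)\<bar>)
     = \<bar>cdf (distr M borel U) a - cdf (distr M borel U) c\<bar>"
proof -
  have *: "expectation (\<lambda>x. \<bar>indicat_real {..a} (U x) - indicat_real {..c} (U x)\<bar>)
     = \<bar>cdf (distr M borel U) a - cdf (distr M borel U) c\<bar>" if "a \<le> c" for a c
  proof -
    have i: "integrable M (\<lambda>x. indicat_real {..a} (U x))" for a
      by (rule integrable_bounded[where B=1]) (auto simp: indicator_def)
    have "\<bar>indicat_real {..a} y - indicat_real {..c} y\<bar> = indicat_real {..c} y - indicat_real {..a} y" for y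
      using that by (auto simp: indicator_def)
    then have e: "expectation (\<lambda>x. \<bar>indicat_real {..a} (U x) - indicat_real {..c} (U x)\<bar>)
       = cdf (distr M borel U) c - cdf (distr M borel U) a"
      using i by (simp add: expectation_indicator_atMost)
    have "0 \<le> expectation (\<lambda>x. \<bar>indicat_real {..a} (U x) - indicat_real {..c} (U x)\<bar>)" by simp
    then show ?thesis unfolding e by simp
  qed
  show ?thesis
  proof (cases "a \<le> c")
    case False
    then show ?thesis using *[of c a] by (simp add: abs_minus_commute)
  qed (rule *)
qed

context mixing_process
begin

text \<open>The quantifier order matters: \<open>s\<close> is obtained at the fixed threshold
  \<open>t\<close>, before \<open>th\<close> is given. Adding the limiting drift \<open>u\<close>
  makes the limit law centred and the same for all \<open>th\<close>.\<close>

lemma empirical_process_clt: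
  fixes t p :: real
  assumes F: "\<And>i. F = cdf (distr P borel (X i))" and Ft: "F t = p"
  shows "\<exists>s\<ge>0. \<forall>(th :: nat \<Rightarrow> real) u. (\<lambda>n. F (th n)) \<longlonglongrightarrow> p \<longrightarrow> (\<lambda>n. sqrt (real n) * (F (th n) - p)) \<longlonglongrightarrow> u \<longrightarrow>
     weak_conv_m (\<lambda>n. distr P borel (\<lambda>\<omega>. (\<Sum>j\<in>{1..int n}. p - indicat_real {..th n} (X j \<omega>)) / sqrt (real n) + u))
        (distr std_normal_distribution borel (\<lambda>y. sqrt s * y))"
proof -
  interpret D: real_distribution "distr P borel (X 0)" by (rule real_distribution_distr) simp
  have F01: "0 \<le> F y" "F y \<le> 1" for y
    using D.cdf_nonneg D.cdf_bounded_prob F[of 0] by auto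
  have Fmono: "mono F" using D.cdf_nondecreasing F[of 0] by (auto intro: monoI)
  have E: "expectation (\<lambda>x. indicat_real {..a} (X i x)) = F a" for a i
    using expectation_indicator_atMost[OF X_measurable] F[of i] by simp
  have int[simp]: "integrable P (\<lambda>x. indicat_real {..a} (X i x))" for a i
    by (rule integrable_bounded[where B=1]) (auto simp: indicator_def)
  let ?N = "\<lambda>n \<omega>. (\<Sum>j\<in>{1..int n}. p - indicat_real {..t} (X j \<omega>)) / sqrt (real n)"
  have "\<bar>p - indicat_real {..t} y\<bar> \<le> 1" for y
    using F01[of t] Ft by (auto simp: indicator_def)
  moreover have "expectation (\<lambda>x. p - indicat_real {..t} (X i x)) = 0" for i
    by (simp add: E Ft prob_space)
  ultimately obtain s where s: "0 \<le> s"
      "\<And>\<tau>. (\<lambda>n. expectation (\<lambda>x. iexp (\<tau> * ?N n x))) \<longlonglongrightarrow> complex_of_real (exp (- (s * \<tau>\<^sup>2 / 2)))"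
    using bounded_mixing_clt[of "\<lambda>y. p - indicat_real {..t} y"] by auto
  show ?thesis
  proof (intro exI[of _ s] conjI allI impI s(1))
    fix th :: "nat \<Rightarrow> real" and u
    assume th: "(\<lambda>n. F (th n)) \<longlonglongrightarrow> p" and u: "(\<lambda>n. sqrt (real n) * (F (th n) - p)) \<longlonglongrightarrow> u"
    let ?V = "\<lambda>n \<omega>. (\<Sum>j\<in>{1..int n}. p - indicat_real {..th n} (X j \<omega>)) / sqrt (real n) + u"
    define \<delta> where "\<delta> n = F (th n) - p" for n
    define g where "g n y = indicat_real {..t} y - indicat_real {..th n} y + \<delta> n" for n y
    have g_meas[measurable]: "g n \<in> borel_measurable borel" for n unfolding g_def by measurable
    \<comment> \<open>The difference of the indicators and \<open>\<delta> n\<close> have opposite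
      signs by monotonicity, which yields the required bound 1 instead of 2.\<close>
    have g_bdd: "\<bar>g n y\<bar> \<le> 1" for n y
    proof (cases "t \<le> th n")
      case True
      then show ?thesis using monoD[OF Fmono True] F01[of "th n"] F01[of t] Ft
        by (auto simp: g_def \<delta>_def indicator_def)
    next
      case False
      then show ?thesis using monoD[OF Fmono, of "th n" t] F01[of "th n"] F01[of t] Ft
        by (auto simp: g_def \<delta>_def indicator_def)
    qed
    have g_mean: "expectation (\<lambda>x. g n (X i x)) = 0" for n i
      by (simp add: g_def E Ft \<delta>_def prob_space)
    have g_int: "integrable P (\<lambda>x. g n (X i x))" for n i
      by (rule integrable_bounded[where B=1]) (auto simp: g_bdd)
    have g_abs: "expectation (\<lambda>x. \<bar>g n (X i x)\<bar>) \<le> 2 * \<bar>\<delta> n\<bar>" for n i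
    proof -
      have "expectation (\<lambda>x. \<bar>g n (X i x)\<bar>)
         \<le> expectation (\<lambda>x. \<bar>indicat_real {..t} (X i x) - indicat_real {..th n} (X i x)\<bar> + \<bar>\<delta> n\<bar>)"
        using g_int by (intro integral_mono) (auto simp: g_def)
      also have "\<dots> = \<bar>F t - F (th n)\<bar> + \<bar>\<delta> n\<bar>"
        using expectation_indicator_diff[OF X_measurable[of i], of t "th n"] F[of i] by (simp add: prob_space)
      finally show ?thesis by (simp add: \<delta>_def Ft abs_minus_commute)
    qed
    let ?W = "\<lambda>n x. (\<Sum>j\<in>{1..int n}. g n (X j x)) / sqrt (real n)"
    have "(\<lambda>n. 2 * \<bar>\<delta> n\<bar>) \<longlonglongrightarrow> 2 * \<bar>p - p\<bar>"
      unfolding \<delta>_def by (intro tendsto_intros th)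
    then have W: "(\<lambda>n. expectation (\<lambda>x. \<bar>?W n x\<bar>)) \<longlonglongrightarrow> 0"
      by (intro normalized_sum_tendsto_0[where d="\<lambda>n. 2 * \<bar>\<delta> n\<bar>"] g_meas g_bdd g_mean g_abs) simp
    \<comment> \<open>Two errors are collected: the fluctuation caused by moving the threshold, and
      the deviation of the actual drift from its limit \<open>u\<close>.\<close>
    define R where "R n x = ?W n x + (u - sqrt (real n) * \<delta> n)" for n x
    have W_int: "integrable P (?W n)" for n using g_int by auto
    have R_int: "integrable P (R n)" for n unfolding R_def using W_int by auto
    have R: "(\<lambda>n. expectation (\<lambda>x. \<bar>R n x\<bar>)) \<longlonglongrightarrow> 0"
    proof (rule tendsto_sandwich[where f="\<lambda>_. 0"])
      have "(\<lambda>n. expectation (\<lambda>x. \<bar>?W n x\<bar>) + \<bar>u - sqrt (real n) * \<delta> n\<bar>) \<longlonglongrightarrow> 0 + \<bar>u - u\<bar>"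
        unfolding \<delta>_def by (intro tendsto_intros W u)
      then show "(\<lambda>n. expectation (\<lambda>x. \<bar>?W n x\<bar>) + \<bar>u - sqrt (real n) * \<delta> n\<bar>) \<longlonglongrightarrow> 0" by simp
      have "expectation (\<lambda>x. \<bar>R n x\<bar>) \<le> expectation (\<lambda>x. \<bar>?W n x\<bar>) + \<bar>u - sqrt (real n) * \<delta> n\<bar>" for n
      proof -
        have "expectation (\<lambda>x. \<bar>R n x\<bar>) \<le> expectation (\<lambda>x. \<bar>?W n x\<bar> + \<bar>u - sqrt (real n) * \<delta> n\<bar>)"
        proof (rule integral_mono)
          show "integrable P (\<lambda>x. \<bar>R n x\<bar>)" using R_int by simp
          show "integrable P (\<lambda>x. \<bar>?W n x\<bar> + \<bar>u - sqrt (real n) * \<delta> n\<bar>)"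
            by (rule Bochner_Integration.integrable_add[OF integrable_abs[OF W_int]]) simp
          show "\<bar>R n x\<bar> \<le> \<bar>?W n x\<bar> + \<bar>u - sqrt (real n) * \<delta> n\<bar>" for x unfolding R_def by (rule abs_triangle_ineq)
        qed
        also have "\<dots> = expectation (\<lambda>x. \<bar>?W n x\<bar>) + \<bar>u - sqrt (real n) * \<delta> n\<bar>"
          by (subst Bochner_Integration.integral_add[OF integrable_abs[OF W_int]]) (auto simp: prob_space)
        finally show ?thesis .
      qed
      then show "\<forall>\<^sub>F n in sequentially. expectation (\<lambda>x. \<bar>R n x\<bar>) \<le> expectation (\<lambda>x. \<bar>?W n x\<bar>) + \<bar>u - sqrt (real n) * \<delta> n\<bar>"
        by simp
    qed simp_all
    have V: "?V n x = ?N n x + R n x" for n x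
    proof -
      have "(\<Sum>j\<in>{1..int n}. p - indicat_real {..th n} (X j x))
         = (\<Sum>j\<in>{1..int n}. p - indicat_real {..t} (X j x)) + (\<Sum>j\<in>{1..int n}. g n (X j x)) - real n * \<delta> n"
        by (simp add: g_def sum.distrib sum_subtractf)
      then show ?thesis
        by (simp add: R_def add_divide_distrib diff_divide_distrib real_div_sqrt flip: times_divide_eq_left)
    qed
    have N_meas[measurable]: "?N n \<in> borel_measurable P" for n by measurable
    have V_meas[measurable]: "?V n \<in> borel_measurable P" for n by measurable
    have char: "(\<lambda>n. expectation (\<lambda>x. iexp (\<tau> * ?V n x))) \<longlonglongrightarrow> complex_of_real (exp (- (s * \<tau>\<^sup>2 / 2)))" for \<tau>
    proof (rule Lim_transform[OF s(2)])
      show "(\<lambda>n. expectation (\<lambda>x. iexp (\<tau> * ?V n x)) - expectation (\<lambda>x. iexp (\<tau> * ?N n x))) \<longlonglongrightarrow> 0"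
      proof (rule Lim_null_comparison)
        show "\<forall>\<^sub>F n in sequentially. norm (expectation (\<lambda>x. iexp (\<tau> * ?V n x)) - expectation (\<lambda>x. iexp (\<tau> * ?N n x)))
            \<le> \<bar>\<tau>\<bar> * expectation (\<lambda>x. \<bar>R n x\<bar>)"
          unfolding V by (intro always_eventually allI expectation_iexp_perturb_le N_meas R_int)
        show "(\<lambda>n. \<bar>\<tau>\<bar> * expectation (\<lambda>x. \<bar>R n x\<bar>)) \<longlonglongrightarrow> 0"
          using tendsto_mult_right_zero[OF R] .
      qed
    qed
    interpret Z: real_distribution std_normal_distribution by (rule real_dist_normal_dist)
    show "weak_conv_m (\<lambda>n. distr P borel (?V n)) (distr std_normal_distribution borel (\<lambda>y. sqrt s * y))"
    proof (rule levy_continuity)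
      show "real_distribution (distr P borel (?V n))" for n by (rule real_distribution_distr) measurable
      show "real_distribution (distr std_normal_distribution borel (\<lambda>y. sqrt s * y))"
        by (rule Z.real_distribution_distr) simp
      fix \<tau>
      have "Characteristic_Functions.char (distr P borel (?V n)) \<tau> = expectation (\<lambda>x. iexp (\<tau> * ?V n x))" for n
        unfolding char_def by (rule integral_distr) measurable
      moreover have "Characteristic_Functions.char (distr std_normal_distribution borel (\<lambda>y. sqrt s * y)) \<tau>
          = Characteristic_Functions.char std_normal_distribution (\<tau> * sqrt s)"
        unfolding char_def by (subst integral_distr) (auto simp: mult.assoc)
      moreover have "\<dots> = complex_of_real (exp (- (s * \<tau>\<^sup>2 / 2)))"
        using s(1) by (simp add: char_std_normal_distribution power_mult_distrib mult.commute)
      ultimately show "(\<lambda>n. Characteristic_Functions.char (distr P borel (?V n)) \<tau>)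
          \<longlonglongrightarrow> Characteristic_Functions.char (distr std_normal_distribution borel (\<lambda>y. sqrt s * y)) \<tau>"
        using char[of \<tau>] by simp
    qed
  qed
qed

end

theorem theorem2:
  fixes P :: "'a measure" and X :: "int \<Rightarrow> 'a \<Rightarrow> real" and F :: "real \<Rightarrow> real"
    and p t\<^sub>p \<rho> M :: real
  assumes "prob_space P"
    and "0 < p" and "p < 1"
    and "\<And>i. X i \<in> borel_measurable P"
    and "stationary P X"
    and "strongly_mixing P X"
    and "\<And>i. F = cdf (distr P borel (X i))"
    and "t\<^sub>p = quantile F p"
    and "\<rho> > 0" and "M \<noteq> 0"
    and "(\<lambda>h. F (t\<^sub>p + h) - F t\<^sub>p - M * \<bar>h\<bar> powr \<rho> * sgn h) \<in> o[at 0](\<lambda>h. \<bar>h\<bar> powr \<rho>)"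
    and "summable (\<lambda>n. mixing_coeff P X (Suc n))"
  shows "\<exists>(C::real) (Q::real measure) (W::real \<Rightarrow> real) (\<mu>::real) (\<sigma>::real).
           prob_space Q \<and> \<sigma> > 0 \<and> distributed Q lborel W (normal_density \<mu> \<sigma>) \<and>
           weak_conv_m
             (\<lambda>n. distr P borel
                (\<lambda>\<omega>. real n powr (1 / (2 * \<rho>)) * (quantile (empirical_cdf X n \<omega>) p - t\<^sub>p)))
             (distr Q borel (\<lambda>\<omega>. C * \<bar>W \<omega>\<bar> powr (1 / \<rho>) * sgn (W \<omega>)))"
proof -
  note p = \<open>0 < p\<close> \<open>p < 1\<close> and \<rho> = \<open>\<rho> > 0\<close> and F = assms(7) and tp = \<open>t\<^sub>p = quantile F p\<close>
  interpret mixing_process P X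
    using assms by (simp add: mixing_process_def mixing_process_axioms_def)
  interpret D: real_distribution "distr P borel (X 0)" by (rule real_distribution_distr) simp
  interpret Z: real_distribution std_normal_distribution by (rule real_dist_normal_dist)
  note [measurable] = X_measurable
  have Fmono: "mono F" using D.cdf_nondecreasing F[of 0] by (auto intro: monoI)
  have quantile_F: "quantile F p \<le> y \<longleftrightarrow> p \<le> F y" for y
  proof (rule quantile_le_iff[OF Fmono])
    show "continuous (at_right a) F" for a using D.cdf_is_right_cont F[of 0] by simp
    have "\<forall>\<^sub>F a in at_top. p < F a"
      unfolding F[of 0] by (rule order_tendstoD(1)[OF D.cdf_lim_at_top_prob p(2)])
    then obtain a where "p < F a" by (auto simp: eventually_at_top_linorder)
    then show "{a. p \<le> F a} \<noteq> {}" by (auto intro: exI[of _ a])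
    have "\<forall>\<^sub>F a in at_bot. F a < p"
      unfolding F[of 0] by (rule order_tendstoD(2)[OF D.cdf_lim_at_bot p(1)])
    then obtain c where "F c < p" by (auto simp: eventually_at_bot_linorder)
    then have "c \<le> a" if "p \<le> F a" for a using that monoD[OF Fmono, of a c] by linarith
    then show "bdd_below {a. p \<le> F a}" by (intro bdd_belowI[of _ c]) simp
  qed
  \<comment> \<open>For positive n this is the reciprocal of the normalizing factor in the
    theorem.\<close>
  define k where "k n = real n powr (- 1 / (2 * \<rho>))" for n :: nat
  have expansion: "(\<lambda>n. sqrt (real n) * (F (t\<^sub>p + x * k n) - F t\<^sub>p)) \<longlonglongrightarrow> M * signed_powr \<rho> x" for x
    unfolding k_def by (rule expansion_tendsto[OF \<rho> assms(11)])
  have F_lim: "(\<lambda>n. F (t\<^sub>p + x * k n)) \<longlonglongrightarrow> F t\<^sub>p" for x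
  proof -
    have "(\<lambda>n. 1 / sqrt (real n)) \<longlonglongrightarrow> 0"
      by (intro tendsto_divide_0[OF tendsto_const] filterlim_at_top_imp_at_infinity
          filterlim_compose[OF sqrt_at_top filterlim_real_sequentially])
    from tendsto_mult[OF this expansion[of x]]
    have "(\<lambda>n. 1 / sqrt (real n) * (sqrt (real n) * (F (t\<^sub>p + x * k n) - F t\<^sub>p))) \<longlonglongrightarrow> 0" by simp
    moreover have "\<forall>\<^sub>F n in sequentially. 1 / sqrt (real n) * (sqrt (real n) * (F (t\<^sub>p + x * k n) - F t\<^sub>p))
        = F (t\<^sub>p + x * k n) - F t\<^sub>p"
      using eventually_gt_at_top[of 0] by eventually_elim simp
    ultimately show ?thesis by (simp add: filterlim_cong LIM_zero_iff)
  qed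
  have k_pos: "0 < k n" if "0 < n" for n using that by (simp add: k_def)
  \<comment> \<open>The sign of M is read off from the expansion at x = 1, since F does not decrease
    to the right of t_p.\<close>
  have "0 \<le> M * signed_powr \<rho> 1"
  proof (rule LIMSEQ_le_const[OF expansion])
    show "\<exists>N. \<forall>n\<ge>N. 0 \<le> sqrt (real n) * (F (t\<^sub>p + 1 * k n) - F t\<^sub>p)"
      using monoD[OF Fmono] by (auto simp: k_def intro!: exI[of _ 0])
  qed
  then have M: "0 < M" using \<open>M \<noteq> 0\<close> by (simp add: signed_powr_def)
  \<comment> \<open>Points to the left of the quantile have F below p, and the expansion makes F
    continuous at t_p along them, so F cannot jump over p.\<close>
  have Ft: "F t\<^sub>p = p"
  proof (rule antisym)
    show "F t\<^sub>p \<le> p"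
    proof (rule LIMSEQ_le_const2[OF F_lim[of "- 1"]])
      have "F (t\<^sub>p + - 1 * k n) \<le> p" if "1 \<le> n" for n
        using quantile_F[of "t\<^sub>p + - 1 * k n"] k_pos[of n] that tp by auto
      then show "\<exists>N. \<forall>n\<ge>N. F (t\<^sub>p + - 1 * k n) \<le> p" by blast
    qed
    show "p \<le> F t\<^sub>p" using quantile_F[of t\<^sub>p] tp by simp
  qed
  obtain s where s: "0 \<le> s" and conv: "\<And>th u. (\<lambda>n. F (th n)) \<longlonglongrightarrow> p \<Longrightarrow> (\<lambda>n. sqrt (real n) * (F (th n) - p)) \<longlonglongrightarrow> u \<Longrightarrow>
     weak_conv_m (\<lambda>n. distr P borel (\<lambda>\<omega>. (\<Sum>j\<in>{1..int n}. p - indicat_real {..th n} (X j \<omega>)) / sqrt (real n) + u))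
        (distr std_normal_distribution borel (\<lambda>y. sqrt s * y))"
    using empirical_process_clt[OF F Ft] by blast
  \<comment> \<open>Solves M * C^\<rho> = sqrt s, so that \<open>u\<close> maps the claimed limit
    variable to \<open>sqrt s * y\<close>; for s = 0 this gives C = 0.\<close>
  define C where "C = (sqrt s / M) powr (1 / \<rho>)"
  let ?L = "distr std_normal_distribution borel (\<lambda>\<omega>. C * \<bar>\<omega>\<bar> powr (1 / \<rho>) * sgn \<omega>)"
  let ?N = "distr std_normal_distribution borel (\<lambda>y. sqrt s * y)"
  let ?T = "\<lambda>n \<omega>. real n powr (1 / (2 * \<rho>)) * (quantile (empirical_cdf X n \<omega>) p - t\<^sub>p)"
  interpret L: real_distribution ?L by (rule Z.real_distribution_distr) measurable
  interpret N: real_distribution ?N by (rule Z.real_distribution_distr) measurable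
  define u where "u x = M * signed_powr \<rho> x" for x
  have powr_C: "C powr \<rho> = sqrt s / M"
    using s M \<rho> by (simp add: C_def powr_powr)
  have scale: "u (C * \<bar>y\<bar> powr (1 / \<rho>) * sgn y) = sqrt s * y" for y
    using M \<rho> signed_powr_mult[of C \<rho> "signed_powr (1 / \<rho>) y"] signed_powr_inverse[OF \<rho>, of y] powr_C
    by (simp add: u_def signed_powr_def[of "1 / \<rho>"] C_def mult.assoc)
  have u_mono: "strict_mono u"
    unfolding u_def using M signed_powr_strict_mono[OF \<rho>] by (auto simp: strict_mono_def)
  have L_le: "C * \<bar>y\<bar> powr (1 / \<rho>) * sgn y \<le> x \<longleftrightarrow> sqrt s * y \<le> u x" for x y
    using strict_mono_less_eq[OF u_mono] scale by metis
  have L_eq: "C * \<bar>y\<bar> powr (1 / \<rho>) * sgn y = x \<longleftrightarrow> sqrt s * y = u x" for x y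
    using strict_mono_eq[OF u_mono] scale by metis
  have cdf_L: "cdf ?L x = cdf ?N (u x)" for x
    unfolding cdf_def by (simp add: measure_distr vimage_def L_le)
  \<comment> \<open>A distribution function is continuous exactly where its law has no atom, so
    continuity points of \<open>?L\<close> and \<open>?N\<close> correspond under \<open>u\<close>.
    This covers s = 0, where \<open>?N\<close> is the point mass at 0.\<close>
  have atom_L: "measure ?L {x} = measure ?N {u x}" for x
    by (simp add: measure_distr vimage_def L_eq)
  have "weak_conv_m (\<lambda>n. distr P borel (?T n)) ?L"
    unfolding weak_conv_m_def weak_conv_def
  proof (intro allI impI)
    fix x assume "isCont (cdf ?L) x"
    then have "isCont (cdf ?N) (u x)" by (simp add: L.isCont_cdf N.isCont_cdf atom_L)
    define th where "th n = t\<^sub>p + x * k n" for n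
    let ?V = "\<lambda>n \<omega>. (\<Sum>j\<in>{1..int n}. p - indicat_real {..th n} (X j \<omega>)) / sqrt (real n) + u x"
    have "weak_conv_m (\<lambda>n. distr P borel (?V n)) ?N"
      by (rule conv) (use F_lim[of x] expansion[of x] Ft in \<open>auto simp: th_def u_def\<close>)
    then have "(\<lambda>n. cdf (distr P borel (?V n)) (u x)) \<longlonglongrightarrow> cdf ?N (u x)"
      using \<open>isCont (cdf ?N) (u x)\<close> by (auto simp: weak_conv_m_def weak_conv_def)
    \<comment> \<open>The two values agree exactly for n > 0, because quantile inversion is an
      equivalence of events; n = 0 is excluded because of the divisions by n and by
      \<open>k n\<close>.\<close>
    moreover have "\<forall>\<^sub>F n in sequentially. cdf (distr P borel (?V n)) (u x) = cdf (distr P borel (?T n)) x"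
      using eventually_gt_at_top[of 0]
    proof eventually_elim
      case (elim n)
      have T_le: "?T n \<omega> \<le> y \<longleftrightarrow> p \<le> empirical_cdf X n \<omega> (t\<^sub>p + y * k n)" for \<omega> y
      proof -
        have "real n powr (1 / (2 * \<rho>)) * k n = 1" using elim by (simp add: k_def flip: powr_add)
        then have inv: "real n powr (1 / (2 * \<rho>)) = 1 / k n" using k_pos[OF elim] by (simp add: field_simps)
        have gen: "1 / c * (q - a) \<le> y \<longleftrightarrow> q \<le> a + y * c" if "0 < c" for a c q :: real
          using that by (simp add: field_simps)
        show ?thesis
          unfolding inv gen[OF k_pos[OF elim]] by (rule quantile_empirical_le_iff[OF p elim])
      qed
      have emp[measurable]: "(\<lambda>\<omega>. empirical_cdf X n \<omega> a) \<in> borel_measurable P" for a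
        unfolding empirical_cdf_def by measurable
      \<comment> \<open>The quantile is an infimum over an uncountable set; its measurability
        follows from \<open>T_le\<close>, which expresses its sublevel sets through the empirical
        distribution function.\<close>
      have T_meas: "?T n \<in> borel_measurable P"
      proof (rule borel_measurable_iff_le[THEN iffD2], rule allI)
        fix a
        have "{\<omega>\<in>space P. p \<le> empirical_cdf X n \<omega> (t\<^sub>p + a * k n)} \<in> sets P" by measurable
        then show "{\<omega>\<in>space P. ?T n \<omega> \<le> a} \<in> sets P" by (simp only: T_le)
      qed
      have V_meas: "?V n \<in> borel_measurable P" by measurable
      have "cdf (distr P borel (?T n)) x = prob {\<omega>\<in>space P. ?T n \<omega> \<le> x}"
        unfolding cdf_def by (subst measure_distr[OF T_meas]) (auto intro!: arg_cong[where f=prob])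
      also have "\<dots> = prob {\<omega>\<in>space P. ?V n \<omega> \<le> u x}"
        by (simp add: T_le empirical_cdf_ge_iff[OF elim] th_def)
      also have "\<dots> = cdf (distr P borel (?V n)) (u x)"
        unfolding cdf_def by (subst measure_distr[OF V_meas]) (auto intro!: arg_cong[where f=prob])
      finally show ?case ..
    qed
    ultimately have "(\<lambda>n. cdf (distr P borel (?T n)) x) \<longlonglongrightarrow> cdf ?N (u x)"
      by (rule Lim_transform_eventually)
    then show "(\<lambda>n. cdf (distr P borel (?T n)) x) \<longlonglongrightarrow> cdf ?L x" by (simp add: cdf_L)
  qed
  moreover have "distributed std_normal_distribution lborel (\<lambda>x. x) (normal_density 0 1)"
    by (auto simp: distributed_def intro!: distr_id2)
  moreover have "prob_space std_normal_distribution" by (rule Z.prob_space_axioms)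
  ultimately show ?thesis
    by (intro exI[of _ C] exI[of _ std_normal_distribution] exI[of _ "\<lambda>x. x"] exI[of _ 0] exI[of _ 1]) auto
qed

end
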